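(* Let $\mathbb{F}_1$ be the first Hirzebruch surface. For every $x\in(0,1)\setminus\{2-\sqrt3\}$, let $g_x$ be Calabi's admissible extremal Kähler metric on $\mathbb{F}_1$ in the Kähler class $[\omega_x]$, and set $$b=-\frac{x(1-4x+x^2)}{1+2x-3x^2+2x^3}.$$ Then $b\in(-1,0)\cup(0,1)$ and $g_x$ is both extremal and $(b\mathfrak z+1,4)$-extremal; that is, $(g_x,1)$ and $(g_x,b\mathfrak z+1)$ are a pair of $4$-weighted extremal Kähler twins.
   Context: **Weighted extremal metrics and twins.** On a Kähler manifold $(N,J,g,\omega)$, a Killing potential is a smooth real function $f$ with $\mathcal{L}_{\nabla^g f}J=0$ (constants allowed). For $p\in\mathbb{R}$ and a positive Killing potential $f$, put $$Scal_{f,p}(g)=f^2\,Scal(g)-2(p-1)f\Delta_g f-p(p-1)|df|_g^2,$$ where $\Delta_g=d^*d$. The metric $g$ is $(f,p)$-extremal if $Scal_{f,p}(g)$ is a Killing potential; $(1,p)$-extremal means extremal in Calabi's sense. If $f_1,f_2>0$ are Killing potentials not constant rescalings of each other and $g$ is both $(f_1,p)$- and $(f_2,p)$-extremal, then $(g,f_1)$ and $(g,f_2)$ are $p$-weighted extremal Kähler twins. **Admissible metrics on $\mathbb{F}_1=\mathbb{P}(\mathcal{O}\oplus\mathcal{O}(1))\to\mathbb{CP}^1$.** Let $g_{\mathbb{CP}^1}$ be the Kähler metric of constant scalar curvature $4$ on $\mathbb{CP}^1$, with Kähler form $\omega_{\mathbb{CP}^1}$, so that $c_1(\mathcal{O}(1))=[\omega_{\mathbb{CP}^1}/2\pi]$.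 Let $\mathfrak{z}:\mathbb{F}_1\to[-1,1]$ be the moment map of the fibrewise circle action, with $\mathfrak z^{-1}(\pm1)$ the zero/infinity sections, and $\theta$ a connection $1$-form on the complement of these sections with $d\theta=\omega_{\mathbb{CP}^1}$ (and $\theta=1$ on the generator $K=J\,\mathrm{grad}\,\mathfrak z$ of the circle action). For $x\in(0,1)$ an admissible metric is $$g=\frac{1+x\mathfrak z}{x}g_{\mathbb{CP}^1}+\frac{d\mathfrak z^2}{\Theta(\mathfrak z)}+\Theta(\mathfrak z)\theta^2,\qquad \omega_x=\frac{1+x\mathfrak z}{x}\omega_{\mathbb{CP}^1}+d\mathfrak z\wedge\theta,$$ with $Jd\mathfrak z=\Theta\theta$ and the base complex structure pulled back, where $\Theta(\mathfrak z)=F(\mathfrak z)/(1+x\mathfrak z)$ with $F$ smooth on $[-1,1]$, $F>0$ on $(-1,1)$, $F(\pm1)=0$, $F'(\pm1)=\mp2(1\pm x)$. For each $x$ there is exactly one such $F$ for which the metric is extremal in Calabi's sense; this is Calabi's admissible extremal metric $g_x$. *)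

theory Defs
  imports "HOL-Analysis.Analysis"
begin

section \<open>Smooth functions on open subsets of a Euclidean space\<close>

abbreviation dir_deriv :: "('e::real_normed_vector \<Rightarrow> 'f::real_normed_vector) \<Rightarrow> 'e \<Rightarrow> 'e \<Rightarrow> 'f"
  where "dir_deriv f x v \<equiv> frechet_derivative f (at x) v"

text \<open>Meant for open \<open>S\<close> in finite dimension.\<close>

primrec Ck_on :: "nat \<Rightarrow> 'e::real_normed_vector set \<Rightarrow> ('e \<Rightarrow> 'f::real_normed_vector) \<Rightarrow> bool"
  where
    "Ck_on 0 S f \<longleftrightarrow> continuous_on S f"
  | "Ck_on (Suc k) S f \<longleftrightarrow>
       f differentiable_on S \<and> (\<forall>v. Ck_on k S (\<lambda>x. dir_deriv f x v))"

definition smooth_on :: "'e::real_normed_vector set \<Rightarrow> ('e \<Rightarrow> 'f::real_normed_vector) \<Rightarrow> bool"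
  where "smooth_on S f \<longleftrightarrow> (\<forall>k. Ck_on k S f)"


section \<open>Riemannian geometry in one coordinate chart\<close>

text \<open>
  Inside a chart, all tensor fields are functions on the Euclidean model space \<open>'e\<close>, and a
  vector \<open>u :: 'e\<close> also denotes the coordinate vector field with constant components \<open>u\<close>.
  A metric is \<open>g x u v\<close>. The vectors picked by \<open>THE\<close> exist and are unique because \<open>g x\<close> is
  a (nondegenerate) inner product at the points of interest.
\<close>

type_synonym 'e metric_field = "'e \<Rightarrow> 'e \<Rightarrow> 'e \<Rightarrow> real"

definition sharp :: "'e::euclidean_space metric_field \<Rightarrow> 'e \<Rightarrow> ('e \<Rightarrow> real) \<Rightarrow> 'e"
  where "sharp g x \<alpha> = (THE X. \<forall>v. g x X v = \<alpha> v)"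

definition grad :: "'e::euclidean_space metric_field \<Rightarrow> ('e \<Rightarrow> real) \<Rightarrow> 'e \<Rightarrow> 'e"
  where "grad g f x = sharp g x (dir_deriv f x)"

text \<open>
  The Levi-Civita derivative of the constant field \<open>v\<close> in direction \<open>u\<close>, by the Koszul formula.
\<close>

definition christoffel :: "'e::euclidean_space metric_field \<Rightarrow> 'e \<Rightarrow> 'e \<Rightarrow> 'e \<Rightarrow> 'e"
  where "christoffel g x u v =
    sharp g x (\<lambda>w. (dir_deriv (\<lambda>y. g y v w) x u + dir_deriv (\<lambda>y. g y u w) x v
                    - dir_deriv (\<lambda>y. g y u v) x w) / 2)"

text \<open>
  \<open>R(u,v)w = \<nabla>\<^sub>u\<nabla>\<^sub>v w - \<nabla>\<^sub>v\<nabla>\<^sub>u w\<close> for constant (hence commuting) fields \<open>u, v, w\<close>.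
\<close>

definition riemann :: "'e::euclidean_space metric_field \<Rightarrow> 'e \<Rightarrow> 'e \<Rightarrow> 'e \<Rightarrow> 'e \<Rightarrow> 'e"
  where "riemann g x u v w =
    dir_deriv (\<lambda>y. christoffel g y v w) x u - dir_deriv (\<lambda>y. christoffel g y u w) x v
    + christoffel g x u (christoffel g x v w) - christoffel g x v (christoffel g x u w)"

text \<open>\<open>Ric(v,w)\<close> is the trace of \<open>u \<mapsto> R(u,v)w\<close>; round spheres have positive curvature.\<close>

definition ricci :: "'e::euclidean_space metric_field \<Rightarrow> 'e \<Rightarrow> 'e \<Rightarrow> 'e \<Rightarrow> real"
  where "ricci g x v w = (\<Sum>e\<in>Basis. riemann g x e v w \<bullet> e)"

text \<open>
  The components of \<open>sharp g x (\<lambda>v. e \<bullet> v)\<close> are a row of the inverse matrix of \<open>g x\<close>, so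
  this is the trace of the Ricci tensor with respect to \<open>g\<close>.
\<close>

definition scal :: "'e::euclidean_space metric_field \<Rightarrow> 'e \<Rightarrow> real"
  where "scal g x = (\<Sum>e\<in>Basis. ricci g x e (sharp g x (\<lambda>v. e \<bullet> v)))"

definition divergence :: "'e::euclidean_space metric_field \<Rightarrow> ('e \<Rightarrow> 'e) \<Rightarrow> 'e \<Rightarrow> real"
  where "divergence g X x = (\<Sum>e\<in>Basis. (dir_deriv X x e + christoffel g x e (X x)) \<bullet> e)"

text \<open>\<open>\<Delta>\<^sub>g = d\<^sup>*d\<close>, with \<open>d\<^sup>*\<alpha> = - div(\<alpha>\<^sup>\<sharp>)\<close> on 1-forms: the nonnegative Laplacian.\<close>

definition laplacian :: "'e::euclidean_space metric_field \<Rightarrow> ('e \<Rightarrow> real) \<Rightarrow> 'e \<Rightarrow> real"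
  where "laplacian g f x = - divergence g (grad g f) x"

definition weighted_scal ::
  "'e::euclidean_space metric_field \<Rightarrow> ('e \<Rightarrow> real) \<Rightarrow> real \<Rightarrow> 'e \<Rightarrow> real"
  where "weighted_scal g f p x =
    (f x)\<^sup>2 * scal g x - 2 * (p - 1) * f x * laplacian g f x
    - p * (p - 1) * g x (grad g f x) (grad g f x)"

text \<open>
  \<open>(\<L>\<^sub>X J)v = [X, Jv] - J[X, v]\<close> for a constant field \<open>v\<close>, where
  \<open>[X,Y] = D\<^sub>X Y - D\<^sub>Y X\<close>.
\<close>

definition lie_endo :: "('e::real_normed_vector \<Rightarrow> 'e) \<Rightarrow> ('e \<Rightarrow> 'e \<Rightarrow> 'e) \<Rightarrow> 'e \<Rightarrow> 'e \<Rightarrow> 'e"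
  where "lie_endo X J x v =
    dir_deriv (\<lambda>y. J y v) x (X x) - dir_deriv X x (J x v) + J x (dir_deriv X x v)"

definition lie_oneform ::
  "('e::real_normed_vector \<Rightarrow> 'e) \<Rightarrow> ('e \<Rightarrow> 'e \<Rightarrow> real) \<Rightarrow> 'e \<Rightarrow> 'e \<Rightarrow> real"
  where "lie_oneform X \<theta> x v =
    dir_deriv (\<lambda>y. \<theta> y v) x (X x) + \<theta> x (dir_deriv X x v)"

definition ext_deriv1 :: "('e::real_normed_vector \<Rightarrow> 'e \<Rightarrow> real) \<Rightarrow> 'e \<Rightarrow> 'e \<Rightarrow> 'e \<Rightarrow> real"
  where "ext_deriv1 \<alpha> x u v = dir_deriv (\<lambda>y. \<alpha> y v) x u - dir_deriv (\<lambda>y. \<alpha> y u) x v"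

definition ext_deriv2 ::
  "('e::real_normed_vector \<Rightarrow> 'e \<Rightarrow> 'e \<Rightarrow> real) \<Rightarrow> 'e \<Rightarrow> 'e \<Rightarrow> 'e \<Rightarrow> 'e \<Rightarrow> real"
  where "ext_deriv2 \<omega> x u v w =
    dir_deriv (\<lambda>y. \<omega> y v w) x u + dir_deriv (\<lambda>y. \<omega> y w u) x v + dir_deriv (\<lambda>y. \<omega> y u v) x w"


section \<open>Complex manifolds given by an atlas, and Kaehler metrics on them\<close>

text \<open>
  An atlas has charts indexed by \<open>'i\<close>, with domains in the set of points \<open>'p\<close> and coordinates
  in the complex vector space \<open>'e\<close>, whose multiplication by \<open>\<i>\<close> is the field \<open>Imult\<close>. Charts are
  holomorphic, so the complex structure \<open>J\<close> has the constant value \<open>Imult\<close> in every chart.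
  Functions live on points; tensor fields are families of local representatives,
  one for each chart.
\<close>

record ('p, 'i, 'e) atlas =
  Dom :: "'i \<Rightarrow> 'p set"
  Crd :: "'i \<Rightarrow> 'p \<Rightarrow> 'e"
  Imult :: "'e \<Rightarrow> 'e"

definition points :: "('p, 'i, 'e) atlas \<Rightarrow> 'p set"
  where "points M = (\<Union>i. Dom M i)"

definition Img :: "('p, 'i, 'e) atlas \<Rightarrow> 'i \<Rightarrow> 'e set"
  where "Img M i = Crd M i ` Dom M i"

definition pt :: "('p, 'i, 'e) atlas \<Rightarrow> 'i \<Rightarrow> 'e \<Rightarrow> 'p"
  where "pt M i = inv_into (Dom M i) (Crd M i)"

definition transition :: "('p, 'i, 'e) atlas \<Rightarrow> 'i \<Rightarrow> 'i \<Rightarrow> 'e \<Rightarrow> 'e"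
  where "transition M i j y = Crd M j (pt M i y)"

definition holomorphic_atlas :: "('p, 'i, 'e::euclidean_space) atlas \<Rightarrow> bool"
  where "holomorphic_atlas M \<longleftrightarrow>
    linear (Imult M) \<and> (\<forall>v. Imult M (Imult M v) = - v) \<and>
    (\<forall>i. inj_on (Crd M i) (Dom M i) \<and> open (Img M i)) \<and>
    (\<forall>i j. open (Crd M i ` (Dom M i \<inter> Dom M j)) \<and>
       (\<forall>y \<in> Crd M i ` (Dom M i \<inter> Dom M j). \<exists>T.
          (transition M i j has_derivative T) (at y) \<and> (\<forall>v. T (Imult M v) = Imult M (T v))))"

definition loc :: "('p, 'i, 'e) atlas \<Rightarrow> 'i \<Rightarrow> ('p \<Rightarrow> 'b) \<Rightarrow> 'e \<Rightarrow> 'b"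
  where "loc M i f y = f (pt M i y)"

definition smooth_fun :: "('p, 'i, 'e::euclidean_space) atlas \<Rightarrow> ('p \<Rightarrow> real) \<Rightarrow> bool"
  where "smooth_fun M f \<longleftrightarrow> (\<forall>i. smooth_on (Img M i) (loc M i f))"

definition riemannian_metric ::
  "('p, 'i, 'e::euclidean_space) atlas \<Rightarrow> ('i \<Rightarrow> 'e metric_field) \<Rightarrow> bool"
  where "riemannian_metric M g \<longleftrightarrow>
    (\<forall>i u v. smooth_on (Img M i) (\<lambda>y. g i y u v)) \<and>
    (\<forall>i. \<forall>y \<in> Img M i. bilinear (g i y) \<and> (\<forall>u v. g i y u v = g i y v u)
       \<and> (\<forall>u. u \<noteq> 0 \<longrightarrow> g i y u u > 0)) \<and>
    (\<forall>i j. \<forall>y \<in> Crd M i ` (Dom M i \<inter> Dom M j). \<forall>u v.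
       g i y u v = g j (transition M i j y)
         (dir_deriv (transition M i j) y u) (dir_deriv (transition M i j) y v))"

definition kaehler_form ::
  "('p, 'i, 'e::euclidean_space) atlas \<Rightarrow> ('i \<Rightarrow> 'e metric_field) \<Rightarrow> 'i \<Rightarrow> 'e \<Rightarrow> 'e \<Rightarrow> 'e \<Rightarrow> real"
  where "kaehler_form M g i y u v = g i y (Imult M u) v"

definition kaehler_metric ::
  "('p, 'i, 'e::euclidean_space) atlas \<Rightarrow> ('i \<Rightarrow> 'e metric_field) \<Rightarrow> bool"
  where "kaehler_metric M g \<longleftrightarrow> riemannian_metric M g \<and>
    (\<forall>i. \<forall>y \<in> Img M i.
       (\<forall>u v. g i y (Imult M u) (Imult M v) = g i y u v) \<and>
       (\<forall>u v w. ext_deriv2 (kaehler_form M g i) y u v w = 0))"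

definition killing_potential ::
  "('p, 'i, 'e::euclidean_space) atlas \<Rightarrow> ('i \<Rightarrow> 'e metric_field) \<Rightarrow> ('p \<Rightarrow> real) \<Rightarrow> bool"
  where "killing_potential M g f \<longleftrightarrow> smooth_fun M f \<and>
    (\<forall>i. \<forall>y \<in> Img M i. \<forall>v. lie_endo (grad (g i) (loc M i f)) (\<lambda>_. Imult M) y v = 0)"

text \<open>
  Scalar curvature and weighted scalar curvature do not depend on the chart; they are the
  functions \<open>S\<close> on the manifold represented in every chart by the local expression.
\<close>

definition is_scal ::
  "('p, 'i, 'e::euclidean_space) atlas \<Rightarrow> ('i \<Rightarrow> 'e metric_field) \<Rightarrow> ('p \<Rightarrow> real) \<Rightarrow> bool"
  where "is_scal M g S \<longleftrightarrow> (\<forall>i. \<forall>y \<in> Img M i. loc M i S y = scal (g i) y)"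

definition is_weighted_scal ::
  "('p, 'i, 'e::euclidean_space) atlas \<Rightarrow> ('i \<Rightarrow> 'e metric_field) \<Rightarrow> ('p \<Rightarrow> real) \<Rightarrow> real
    \<Rightarrow> ('p \<Rightarrow> real) \<Rightarrow> bool"
  where "is_weighted_scal M g f p S \<longleftrightarrow>
    (\<forall>i. \<forall>y \<in> Img M i. loc M i S y = weighted_scal (g i) (loc M i f) p y)"

definition extremal ::
  "('p, 'i, 'e::euclidean_space) atlas \<Rightarrow> ('i \<Rightarrow> 'e metric_field) \<Rightarrow> bool"
  where "extremal M g \<longleftrightarrow> kaehler_metric M g \<and>
    (\<exists>S. is_scal M g S \<and> killing_potential M g S)"

definition weighted_extremal ::
  "('p, 'i, 'e::euclidean_space) atlas \<Rightarrow> ('i \<Rightarrow> 'e metric_field) \<Rightarrow> ('p \<Rightarrow> real) \<Rightarrow> real \<Rightarrow> bool"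
  where "weighted_extremal M g f p \<longleftrightarrow> kaehler_metric M g \<and>
    killing_potential M g f \<and> (\<forall>q \<in> points M. f q > 0) \<and>
    (\<exists>S. is_weighted_scal M g f p S \<and> killing_potential M g S)"

definition kaehler_twins ::
  "('p, 'i, 'e::euclidean_space) atlas \<Rightarrow> real \<Rightarrow> ('i \<Rightarrow> 'e metric_field)
    \<Rightarrow> ('p \<Rightarrow> real) \<Rightarrow> ('p \<Rightarrow> real) \<Rightarrow> bool"
  where "kaehler_twins M p g f1 f2 \<longleftrightarrow>
    weighted_extremal M g f1 p \<and> weighted_extremal M g f2 p \<and>
    \<not> (\<exists>c. \<forall>q \<in> points M. f2 q = c * f1 q)"


section \<open>The projective line\<close>

definition cp1_rel :: "complex \<times> complex \<Rightarrow> complex \<times> complex \<Rightarrow> bool"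
  where "cp1_rel u u' \<longleftrightarrow> u \<noteq> 0 \<and> (\<exists>c. c \<noteq> 0 \<and> u' = (c * fst u, c * snd u))"

lemma part_equivp_cp1_rel: "part_equivp cp1_rel"
proof (rule part_equivpI)
  show "\<exists>x. cp1_rel x x"
    by (rule exI[of _ "(1, 1)"]) (auto simp: cp1_rel_def zero_prod_def intro!: exI[of _ 1])
  show "symp cp1_rel"
  proof (rule sympI)
    fix u v assume "cp1_rel u v"
    then obtain c where "u \<noteq> 0" "c \<noteq> 0" "v = (c * fst u, c * snd u)" by (auto simp: cp1_rel_def)
    then show "cp1_rel v u" unfolding cp1_rel_def
      by (auto simp: zero_prod_def prod_eq_iff intro!: exI[of _ "inverse c"])
  qed
  show "transp cp1_rel"
  proof (rule transpI)
    fix u v w assume "cp1_rel u v" "cp1_rel v w"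
    then obtain c d where "u \<noteq> 0" "c \<noteq> 0" "v = (c * fst u, c * snd u)"
      "d \<noteq> 0" "w = (d * fst v, d * snd v)" by (auto simp: cp1_rel_def)
    then show "cp1_rel u w" unfolding cp1_rel_def
      by (auto simp: prod_eq_iff intro!: exI[of _ "d * c"])
  qed
qed

quotient_type cp1 = "complex \<times> complex" / partial: cp1_rel
  by (rule part_equivp_cp1_rel)

datatype base_chart = U0 | U1

definition hom_crd :: "base_chart \<Rightarrow> complex \<times> complex \<Rightarrow> complex"
  where "hom_crd i u = (case i of U0 \<Rightarrow> fst u | U1 \<Rightarrow> snd u)"

lift_definition cp1_dom :: "base_chart \<Rightarrow> cp1 \<Rightarrow> bool"
  is "\<lambda>i u. case i of U0 \<Rightarrow> fst u \<noteq> 0 | U1 \<Rightarrow> snd u \<noteq> 0"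
  by (auto simp: cp1_rel_def split: base_chart.splits)

lift_definition cp1_crd :: "base_chart \<Rightarrow> cp1 \<Rightarrow> complex"
  is "\<lambda>i u. case i of U0 \<Rightarrow> snd u / fst u | U1 \<Rightarrow> fst u / snd u"
  by (auto simp: cp1_rel_def split: base_chart.splits)

definition CP1 :: "(cp1, base_chart, complex) atlas"
  where "CP1 = \<lparr>Dom = \<lambda>i. {q. cp1_dom i q}, Crd = cp1_crd, Imult = (*) \<i>\<rparr>"


section \<open>The first Hirzebruch surface\<close>

text \<open>
  A point of \<open>\<P>(\<O> \<oplus> \<O>(1))\<close> over the line \<open>\<ell> = \<complex>u\<close> in \<open>\<complex>\<^sup>2\<close> is a line in
  \<open>\<complex> \<oplus> \<ell>\<^sup>*\<close>, spanned by some \<open>(s, \<lambda>)\<close>. It is recorded as \<open>(u, (s, a))\<close> with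
  \<open>a = \<lambda>(u)\<close>; replacing \<open>u\<close> by \<open>c u\<close> replaces \<open>a\<close> by \<open>c a\<close>.
\<close>

type_synonym f1_rep = "(complex \<times> complex) \<times> (complex \<times> complex)"

definition f1_rel :: "f1_rep \<Rightarrow> f1_rep \<Rightarrow> bool"
  where "f1_rel = (\<lambda>(u, s, a) (u', s', a'). u \<noteq> 0 \<and> (s, a) \<noteq> 0 \<and>
    (\<exists>c m. c \<noteq> 0 \<and> m \<noteq> 0 \<and> u' = (c * fst u, c * snd u) \<and> s' = m * s \<and> a' = m * c * a))"

lemma f1_relI:
  assumes "u \<noteq> 0" "sa \<noteq> 0" "c \<noteq> 0" "m \<noteq> 0"
    "u' = (c * fst u, c * snd u)" "sa' = (m * fst sa, m * c * snd sa)"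
  shows "f1_rel (u, sa) (u', sa')"
  using assms unfolding f1_rel_def by (cases sa) auto

lemma part_equivp_f1_rel: "part_equivp f1_rel"
proof (rule part_equivpI)
  show "\<exists>x. f1_rel x x"
    by (rule exI[of _ "((1, 1), (1, 1))"])
       (auto simp: f1_rel_def zero_prod_def intro!: exI[of _ 1])
  show "symp f1_rel"
  proof (rule sympI)
    fix p q assume "f1_rel p q"
    then obtain u s a c m where "p = (u, s, a)" "u \<noteq> 0" "(s, a) \<noteq> 0" "c \<noteq> 0" "m \<noteq> 0"
      "q = ((c * fst u, c * snd u), m * s, m * c * a)"
      by (auto simp: f1_rel_def split: prod.splits)
    then have "(c * fst u, c * snd u) \<noteq> 0" "(m * s, m * c * a) \<noteq> 0"
      "u = (inverse c * (c * fst u), inverse c * (c * snd u))" "s = inverse m * (m * s)"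
      "a = inverse m * inverse c * (m * c * a)" "inverse c \<noteq> 0" "inverse m \<noteq> 0"
      by (auto simp: zero_prod_def prod_eq_iff field_simps)
    then show "f1_rel q p" unfolding f1_rel_def \<open>p = _\<close> \<open>q = _\<close> prod.case fst_conv snd_conv by blast
  qed
  show "transp f1_rel"
  proof (rule transpI)
    fix p q r assume "f1_rel p q" "f1_rel q r"
    then obtain u s a c m d n where "p = (u, s, a)" "u \<noteq> 0" "(s, a) \<noteq> 0" "c \<noteq> 0" "m \<noteq> 0"
      "q = ((c * fst u, c * snd u), m * s, m * c * a)" "d \<noteq> 0" "n \<noteq> 0"
      "r = ((d * (c * fst u), d * (c * snd u)), n * (m * s), n * d * (m * c * a))"
      by (auto simp: f1_rel_def split: prod.splits)
    then show "f1_rel p r"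
      by (auto intro!: f1_relI[where c = "d * c" and m = "n * m"])
  qed
qed

quotient_type f1 = f1_rep / partial: f1_rel
  by (rule part_equivp_f1_rel)

lift_definition f1_proj :: "f1 \<Rightarrow> cp1" is fst
  by (auto simp: f1_rel_def cp1_rel_def)

text \<open>The sections \<open>\<P>(\<O> \<oplus> 0)\<close> and \<open>\<P>(0 \<oplus> \<O>(1))\<close>.\<close>

lift_definition on_zero_section :: "f1 \<Rightarrow> bool" is "\<lambda>(u, s, a). a = 0"
  by (auto simp: f1_rel_def)

lift_definition on_infinity_section :: "f1 \<Rightarrow> bool" is "\<lambda>(u, s, a). s = 0"
  by (auto simp: f1_rel_def)

definition zero_section :: "f1 set" where "zero_section = {q. on_zero_section q}"
definition infinity_section :: "f1 set" where "infinity_section = {q. on_infinity_section q}"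

text \<open>
  Chart \<open>(Ui, OffInf)\<close> is defined away from the infinity section and \<open>(Ui, OffZero)\<close> away from the
  zero section, both over the chart \<open>Ui\<close> of the base; the image of each chart is all of \<open>\<complex>\<^sup>2\<close>.
\<close>

datatype fibre_chart = OffInf | OffZero

lift_definition f1_dom :: "base_chart \<times> fibre_chart \<Rightarrow> f1 \<Rightarrow> bool"
  is "\<lambda>(i, j) (u, s, a). hom_crd i u \<noteq> 0 \<and> (case j of OffInf \<Rightarrow> s \<noteq> 0 | OffZero \<Rightarrow> a \<noteq> 0)"
  by (auto simp: f1_rel_def hom_crd_def split: base_chart.splits fibre_chart.splits)

lift_definition f1_crd :: "base_chart \<times> fibre_chart \<Rightarrow> f1 \<Rightarrow> complex \<times> complex"
  is "\<lambda>(i, j) (u, s, a).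
    (case i of U0 \<Rightarrow> snd u / fst u | U1 \<Rightarrow> fst u / snd u,
     case j of OffInf \<Rightarrow> a / (s * hom_crd i u) | OffZero \<Rightarrow> s * hom_crd i u / a)"
  by (auto simp: f1_rel_def hom_crd_def split: base_chart.splits fibre_chart.splits)

definition F1 :: "(f1, base_chart \<times> fibre_chart, complex \<times> complex) atlas"
  where "F1 = \<lparr>Dom = \<lambda>i. {q. f1_dom i q}, Crd = f1_crd,
               Imult = (\<lambda>(a, b). (\<i> * a, \<i> * b))\<rparr>"

lift_definition cp1_pt :: "base_chart \<Rightarrow> complex \<Rightarrow> cp1"
  is "\<lambda>i w. case i of U0 \<Rightarrow> (1, w) | U1 \<Rightarrow> (w, 1)"
  by (auto simp: cp1_rel_def zero_prod_def split: base_chart.splits intro!: exI[of _ 1])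

lift_definition f1_pt :: "base_chart \<times> fibre_chart \<Rightarrow> complex \<times> complex \<Rightarrow> f1"
  is "\<lambda>(i, j) (w, v). (case i of U0 \<Rightarrow> (1, w) | U1 \<Rightarrow> (w, 1),
                        case j of OffInf \<Rightarrow> (1, v) | OffZero \<Rightarrow> (v, 1))"
  by (auto simp: f1_rel_def zero_prod_def split: base_chart.splits fibre_chart.splits
      intro!: exI[of _ 1])

lemma cp1_pt_inverse: "cp1_dom i q \<Longrightarrow> cp1_pt i (cp1_crd i q) = q"
  apply transfer
  subgoal for i q
    by (cases i) (auto simp: cp1_rel_def zero_prod_def prod_eq_iff
        intro!: exI[of _ "hom_crd i q"] simp: hom_crd_def)
  done

lemma cp1_crd_pt [simp]: "cp1_dom i (cp1_pt i w)" "cp1_crd i (cp1_pt i w) = w"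
  by (transfer, simp split: base_chart.splits)+

lemma f1_pt_inverse: "f1_dom i q \<Longrightarrow> f1_pt i (f1_crd i q) = q"
  apply transfer
  subgoal for i q
    apply (cases i; cases q)
    subgoal for i' j u s a
      apply (simp only: prod.case)
      apply (rule f1_relI[where c = "hom_crd i' u" and
             m = "case j of OffInf \<Rightarrow> s | OffZero \<Rightarrow> a / hom_crd i' u"])
      by (auto simp: f1_rel_def zero_prod_def prod_eq_iff hom_crd_def
          split: base_chart.splits fibre_chart.splits)
    done
  done

lemma f1_crd_pt [simp]: "f1_dom i (f1_pt i y)" "f1_crd i (f1_pt i y) = y"
  by (transfer, auto simp: hom_crd_def split: base_chart.splits fibre_chart.splits)+

text \<open>The atlases are as expected: every chart is onto, and transition maps are holomorphic.\<close>

lemma Img_CP1 [simp]: "Img CP1 i = UNIV" and pt_CP1: "pt CP1 i = cp1_pt i"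
proof -
  have inj: "inj_on (cp1_crd i) {q. cp1_dom i q}"
    by (rule inj_on_inverseI[where g = "cp1_pt i"]) (simp add: cp1_pt_inverse)
  show "Img CP1 i = UNIV"
    unfolding Img_def CP1_def
    by simp (metis (mono_tags, lifting) cp1_crd_pt mem_Collect_eq rev_image_eqI UNIV_eq_I)
  show "pt CP1 i = cp1_pt i"
    unfolding pt_def CP1_def by (rule ext) (simp add: inv_into_f_eq[OF inj])
qed

lemma Img_F1 [simp]: "Img F1 i = UNIV" and pt_F1: "pt F1 i = f1_pt i"
proof -
  have inj: "inj_on (f1_crd i) {q. f1_dom i q}"
    by (rule inj_on_inverseI[where g = "f1_pt i"]) (simp add: f1_pt_inverse)
  show "Img F1 i = UNIV"
    unfolding Img_def F1_def
    by simp (metis (mono_tags, lifting) f1_crd_pt mem_Collect_eq rev_image_eqI UNIV_eq_I)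
  show "pt F1 i = f1_pt i"
    unfolding pt_def F1_def by (rule ext) (simp add: inv_into_f_eq[OF inj])
qed

lemma points_F1 [simp]: "points F1 = UNIV"
proof -
  have "\<exists>i j. f1_dom (i, j) q" for q
  proof transfer
    fix q assume "f1_rel q q"
    then obtain u0 u1 s a where q: "q = ((u0, u1), (s, a))"
      and "u0 \<noteq> 0 \<or> u1 \<noteq> 0" "s \<noteq> 0 \<or> a \<noteq> 0"
      by (cases q) (auto simp: f1_rel_def zero_prod_def)
    then have "\<exists>i. hom_crd i (u0, u1) \<noteq> 0"
      "\<exists>j. case j of OffInf \<Rightarrow> s \<noteq> 0 | OffZero \<Rightarrow> a \<noteq> 0"
      by (metis hom_crd_def base_chart.case fst_conv snd_conv, metis fibre_chart.case)
    then show "\<exists>i j. (case (i, j) of (i, j) \<Rightarrow> \<lambda>(u, s, a). hom_crd i u \<noteq> 0 \<and>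
        (case j of OffInf \<Rightarrow> s \<noteq> 0 | OffZero \<Rightarrow> a \<noteq> 0)) q"
      by (simp add: q)
  qed
  then show ?thesis by (auto simp: points_def F1_def)
qed

lemma cp1_crd_pt_other:
  "cp1_dom j (cp1_pt i w) \<longleftrightarrow> i = j \<or> w \<noteq> 0"
  "cp1_crd j (cp1_pt i w) = (if i = j then w else 1 / w)"
  by (transfer, auto split: base_chart.splits)+

lemma f1_crd_pt_other:
  "f1_dom (i', j') (f1_pt (i, j) (w, v)) \<longleftrightarrow> (i = i' \<or> w \<noteq> 0) \<and> (j = j' \<or> v \<noteq> 0)"
  "f1_crd (i', OffInf) (f1_pt (i, OffInf) (w, v)) = (if i = i' then (w, v) else (1 / w, v / w))"
  "f1_crd (i', OffZero) (f1_pt (i, OffZero) (w, v)) = (if i = i' then (w, v) else (1 / w, v * w))"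
  "f1_crd (i', OffZero) (f1_pt (i, OffInf) (w, v)) = (if i = i' then (w, 1 / v) else (1 / w, w / v))"
  "f1_crd (i', OffInf) (f1_pt (i, OffZero) (w, v)) = (if i = i' then (w, 1 / v) else (1 / w, 1 / (v * w)))"
  by (transfer, auto simp: hom_crd_def split: base_chart.splits fibre_chart.splits)+

lemma holomorphic_atlas_CP1: "holomorphic_atlas CP1"
proof -
  have crd: "Crd CP1 i = cp1_crd i" and dom: "Dom CP1 i = {q. cp1_dom i q}"
    and J: "Imult CP1 = (*) \<i>" for i
    by (simp_all add: CP1_def)
  have ov: "cp1_crd i ` ({q. cp1_dom i q} \<inter> {q. cp1_dom j q}) = {w. i = j \<or> w \<noteq> 0}" for i j
  proof (intro equalityI subsetI)
    fix w :: complex assume "w \<in> {w. i = j \<or> w \<noteq> 0}"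
    then show "w \<in> cp1_crd i ` ({q. cp1_dom i q} \<inter> {q. cp1_dom j q})"
      by (intro image_eqI[of _ _ "cp1_pt i w"]) (auto simp: cp1_crd_pt_other)
  next
    fix w assume "w \<in> cp1_crd i ` ({q. cp1_dom i q} \<inter> {q. cp1_dom j q})"
    then obtain q where "w = cp1_crd i q" "cp1_dom i q" "cp1_dom j q" by auto
    then show "w \<in> {w. i = j \<or> w \<noteq> 0}"
      using cp1_crd_pt_other(1)[of j i w] by (simp add: cp1_pt_inverse)
  qed
  have op: "open {w::complex. i = j \<or> w \<noteq> 0}" for i j :: base_chart
    by (cases "i = j") (auto simp: open_Collect_neq)
  have tr: "transition CP1 i j = (if i = j then (\<lambda>w. w) else (\<lambda>w. 1 / w))" for i j
    by (auto simp: transition_def crd pt_CP1 cp1_crd_pt_other fun_eq_iff)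
  have "\<exists>T. (transition CP1 i j has_derivative T) (at w) \<and> (\<forall>v. T (\<i> * v) = \<i> * T v)"
    if "i = j \<or> w \<noteq> 0" for i j w
  proof (cases "i = j")
    case True
    then show ?thesis by (auto simp: tr intro!: exI[of _ "\<lambda>v. v"])
  next
    case False
    with that have "((\<lambda>w. 1 / w) has_derivative (\<lambda>a. - a / w\<^sup>2)) (at w)"
      by (auto intro!: derivative_eq_intros simp: power2_eq_square)
    with False show ?thesis by (auto simp: tr intro!: exI[of _ "\<lambda>a. - a / w\<^sup>2"])
  qed
  moreover have "inj_on (cp1_crd i) {q. cp1_dom i q}" for i
    by (rule inj_on_inverseI[where g = "cp1_pt i"]) (simp add: cp1_pt_inverse)
  ultimately show ?thesis
    unfolding holomorphic_atlas_def crd dom J ov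
    by (auto simp: op intro!: linearI simp: algebra_simps scaleR_conv_of_real)
qed

lemma holomorphic_atlas_F1: "holomorphic_atlas F1"
proof -
  have crd: "Crd F1 i = f1_crd i" and dom: "Dom F1 i = {q. f1_dom i q}"
    and J: "Imult F1 = (\<lambda>(a, b). (\<i> * a, \<i> * b))" for i
    by (simp_all add: F1_def)
  define V where "V i j = {y :: complex \<times> complex.
    (fst i = fst j \<or> fst y \<noteq> 0) \<and> (snd i = snd j \<or> snd y \<noteq> 0)}"
    for i j :: "base_chart \<times> fibre_chart"
  have dom_iff: "f1_dom j (f1_pt i y) \<longleftrightarrow> y \<in> V i j" for i j y
    by (cases i; cases j; cases y) (auto simp: V_def f1_crd_pt_other)
  have ov: "f1_crd i ` ({q. f1_dom i q} \<inter> {q. f1_dom j q}) = V i j" for i j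
  proof (intro equalityI subsetI)
    fix y assume "y \<in> V i j"
    then show "y \<in> f1_crd i ` ({q. f1_dom i q} \<inter> {q. f1_dom j q})"
      by (intro image_eqI[of _ _ "f1_pt i y"]) (auto simp: dom_iff)
  next
    fix y assume "y \<in> f1_crd i ` ({q. f1_dom i q} \<inter> {q. f1_dom j q})"
    then obtain q where "y = f1_crd i q" "f1_dom i q" "f1_dom j q" by auto
    then show "y \<in> V i j" using dom_iff[of j i y] by (simp add: f1_pt_inverse)
  qed
  have op: "open (V i j)" for i j
    unfolding V_def
    by (cases "fst i = fst j"; cases "snd i = snd j")
       (auto intro!: open_Collect_conj open_Collect_neq continuous_intros)
  have hol: "\<exists>T. (transition F1 i j has_derivative T) (at y) \<and>
      (\<forall>v. T (Imult F1 v) = Imult F1 (T v))"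
    if y: "y \<in> V i j" and
      tr: "transition F1 i j = f" and f: "(f has_derivative (\<lambda>h. (A * fst h + B * snd h, C * fst h + D * snd h))) (at y)"
    for i j y f A B C D
    using f unfolding tr J
    by (intro exI[of _ "\<lambda>h. (A * fst h + B * snd h, C * fst h + D * snd h)"])
       (auto simp: algebra_simps)
  have trans: "\<exists>T. (transition F1 i j has_derivative T) (at y) \<and>
      (\<forall>v. T (Imult F1 v) = Imult F1 (T v))" if y: "y \<in> V i j" for i j y
  proof -
    obtain i1 i2 j1 j2 w v where [simp]: "i = (i1, i2)" "j = (j1, j2)" "y = (w, v)"
      by (cases i; cases j; cases y) auto
    have eq: "transition F1 i j y' = f1_crd j (f1_pt i (fst y', snd y'))" for y'
      by (simp add: transition_def crd pt_F1)
    have nz: "i1 \<noteq> j1 \<Longrightarrow> w \<noteq> 0" "i2 \<noteq> j2 \<Longrightarrow> v \<noteq> 0" using y by (auto simp: V_def)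
    consider "i1 = j1" "i2 = j2" | "i1 \<noteq> j1" "i2 = OffInf" "j2 = OffInf"
      | "i1 \<noteq> j1" "i2 = OffZero" "j2 = OffZero" | "i1 = j1" "i2 \<noteq> j2"
      | "i1 \<noteq> j1" "i2 = OffInf" "j2 = OffZero" | "i1 \<noteq> j1" "i2 = OffZero" "j2 = OffInf"
      by (cases i2; cases j2) auto
    then show ?thesis
    proof cases
      case 1
      have "transition F1 i j = (\<lambda>y. y)" using 1 unfolding fun_eq_iff eq by simp
      from hol[OF y this, of 1 0 0 1] show ?thesis by simp
    next
      case 2
      have "transition F1 i j = (\<lambda>y. (1 / fst y, snd y / fst y))"
        using 2 unfolding fun_eq_iff eq by (simp add: f1_crd_pt_other)
      moreover have "((\<lambda>y. (1 / fst y, snd y / fst y)) has_derivative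
          (\<lambda>h. (- 1 / w\<^sup>2 * fst h + 0 * snd h, - v / w\<^sup>2 * fst h + 1 / w * snd h))) (at y)"
        using nz 2
        by (auto intro!: derivative_eq_intros ext simp: divide_simps power2_eq_square)
           (auto simp: algebra_simps)?
      ultimately show ?thesis by (rule hol[OF y])
    next
      case 3
      have "transition F1 i j = (\<lambda>y. (1 / fst y, snd y * fst y))"
        using 3 unfolding fun_eq_iff eq by (simp add: f1_crd_pt_other)
      moreover have "((\<lambda>y. (1 / fst y, snd y * fst y)) has_derivative
          (\<lambda>h. (- 1 / w\<^sup>2 * fst h + 0 * snd h, v * fst h + w * snd h))) (at y)"
        using nz 3
        by (auto intro!: derivative_eq_intros ext simp: divide_simps power2_eq_square)
           (auto simp: algebra_simps)?
      ultimately show ?thesis by (rule hol[OF y])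
    next
      case 4
      have "transition F1 i j = (\<lambda>y. (fst y, 1 / snd y))"
        using 4 unfolding fun_eq_iff eq
        by (cases i2; cases j2) (simp_all add: f1_crd_pt_other)
      moreover have "((\<lambda>y. (fst y, 1 / snd y)) has_derivative
          (\<lambda>h. (1 * fst h + 0 * snd h, 0 * fst h + - 1 / v\<^sup>2 * snd h))) (at y)"
        using nz 4
        by (auto intro!: derivative_eq_intros ext simp: divide_simps power2_eq_square)
           (auto simp: algebra_simps)?
      ultimately show ?thesis by (rule hol[OF y])
    next
      case 5
      have "transition F1 i j = (\<lambda>y. (1 / fst y, fst y / snd y))"
        using 5 unfolding fun_eq_iff eq by (simp add: f1_crd_pt_other)
      moreover have "((\<lambda>y. (1 / fst y, fst y / snd y)) has_derivative
          (\<lambda>h. (- 1 / w\<^sup>2 * fst h + 0 * snd h, 1 / v * fst h + - w / v\<^sup>2 * snd h))) (at y)"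
        using nz 5
        by (auto intro!: derivative_eq_intros ext simp: divide_simps power2_eq_square)
           (auto simp: algebra_simps)?
      ultimately show ?thesis by (rule hol[OF y])
    next
      case 6
      have "transition F1 i j = (\<lambda>y. (1 / fst y, 1 / (snd y * fst y)))"
        using 6 unfolding fun_eq_iff eq by (simp add: f1_crd_pt_other)
      moreover have "((\<lambda>y. (1 / fst y, 1 / (snd y * fst y))) has_derivative
          (\<lambda>h. (- 1 / w\<^sup>2 * fst h + 0 * snd h, - v / (v * w)\<^sup>2 * fst h + - w / (v * w)\<^sup>2 * snd h))) (at y)"
        using nz 6
        by (auto intro!: derivative_eq_intros ext simp: divide_simps power2_eq_square)
           (auto simp: algebra_simps)?
      ultimately show ?thesis by (rule hol[OF y])
    qed
  qed
  moreover have "inj_on (f1_crd i) {q. f1_dom i q}" for i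
    by (rule inj_on_inverseI[where g = "f1_pt i"]) (simp add: f1_pt_inverse)
  moreover have "linear (Imult F1)" "\<forall>v. Imult F1 (Imult F1 v) = - v"
    by (auto simp: J intro!: linearI simp: algebra_simps scaleR_conv_of_real split: prod.splits)
  ultimately show ?thesis
    unfolding holomorphic_atlas_def crd dom ov by (auto simp: op)
qed

lemma f1_proj_crd:
  assumes "f1_dom (i, j) q"
  shows "cp1_dom i (f1_proj q)" "cp1_crd i (f1_proj q) = fst (f1_crd (i, j) q)"
  using assms
  by (transfer, auto simp: hom_crd_def split: base_chart.splits)+


section \<open>Admissible metrics\<close>

text \<open>
  The fibrewise circle action, by scalar multiplication on the summand \<open>\<O>\<close>. This is the
  action whose moment map has its maximum on the zero section \<open>\<P>(\<O> \<oplus> 0)\<close>, for the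
  convention \<open>K = J grad \<zz>\<close>.
\<close>

lift_definition f1_rotate :: "real \<Rightarrow> f1 \<Rightarrow> f1" is "\<lambda>t (u, s, a). (u, cis t * s, a)"
  by (auto simp: f1_rel_def zero_prod_def)

definition circle_gen :: "base_chart \<times> fibre_chart \<Rightarrow> complex \<times> complex \<Rightarrow> complex \<times> complex"
  where "circle_gen i y = vector_derivative (\<lambda>t. Crd F1 i (f1_rotate t (pt F1 i y))) (at 0)"

lemma f1_crd_rotate:
  "f1_crd (i, OffInf) (f1_rotate t (f1_pt (i, OffInf) (w, v))) = (w, cis (- t) * v)"
  "f1_crd (i, OffZero) (f1_rotate t (f1_pt (i, OffZero) (w, v))) = (w, cis t * v)"
  by (transfer, simp add: hom_crd_def divide_inverse split: base_chart.splits)+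

lemma circle_gen_simps:
  "circle_gen (i, OffInf) (w, v) = (0, - \<i> * v)"
  "circle_gen (i, OffZero) (w, v) = (0, \<i> * v)"
proof -
  have *: "((\<lambda>t. (w, cis (k * t) * v)) has_vector_derivative (0, k * \<i> * v)) (at 0)" for k :: real
  proof -
    have "((\<lambda>t. cis (k * t)) has_vector_derivative k *\<^sub>R (\<i> * cis (k * 0))) (at 0)"
      unfolding cis_conv_exp
      by (auto intro!: derivative_eq_intros has_vector_derivative_real_field simp: scaleR_conv_of_real)
    then show ?thesis
      by (auto intro!: has_vector_derivative_Pair has_vector_derivative_mult_left
          simp: scaleR_conv_of_real)
  qed
  show "circle_gen (i, OffInf) (w, v) = (0, - \<i> * v)"
    using vector_derivative_at[OF *[of "-1"]]
    by (simp add: circle_gen_def pt_F1 f1_crd_rotate F1_def[THEN arg_cong[of _ _ Crd]])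
  show "circle_gen (i, OffZero) (w, v) = (0, \<i> * v)"
    using vector_derivative_at[OF *[of 1]]
    by (simp add: circle_gen_def pt_F1 f1_crd_rotate F1_def[THEN arg_cong[of _ _ Crd]])
qed

definition F1_regular :: "f1 set"
  where "F1_regular = - (zero_section \<union> infinity_section)"

definition regular_img :: "base_chart \<times> fibre_chart \<Rightarrow> (complex \<times> complex) set"
  where "regular_img i = Crd F1 i ` (Dom F1 i \<inter> F1_regular)"

text \<open>
  Pullbacks along \<open>f1_proj\<close>: in the chart \<open>(i, j)\<close> of \<open>F1\<close> and the chart \<open>i\<close> of \<open>CP1\<close>
  the projection is \<open>fst\<close> (lemma \<open>f1_proj_crd\<close>).
\<close>

definition pullback_base ::
  "(base_chart \<Rightarrow> complex \<Rightarrow> complex \<Rightarrow> complex \<Rightarrow> real) \<Rightarrow>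
   base_chart \<times> fibre_chart \<Rightarrow> complex \<times> complex \<Rightarrow> complex \<times> complex \<Rightarrow> complex \<times> complex \<Rightarrow> real"
  where "pullback_base h i y u v = h (fst i) (fst y) (fst u) (fst v)"

definition one_form_on ::
  "('p, 'i, 'e::euclidean_space) atlas \<Rightarrow> 'p set \<Rightarrow> ('i \<Rightarrow> 'e \<Rightarrow> 'e \<Rightarrow> real) \<Rightarrow> bool"
  where "one_form_on M U \<theta> \<longleftrightarrow>
    (\<forall>i v. smooth_on (Crd M i ` (Dom M i \<inter> U)) (\<lambda>y. \<theta> i y v)) \<and>
    (\<forall>i. \<forall>y \<in> Crd M i ` (Dom M i \<inter> U). linear (\<theta> i y)) \<and>
    (\<forall>i j. \<forall>y \<in> Crd M i ` (Dom M i \<inter> Dom M j \<inter> U). \<forall>v.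
       \<theta> i y v = \<theta> j (transition M i j y) (dir_deriv (transition M i j) y v))"

definition connection_form ::
  "(base_chart \<times> fibre_chart \<Rightarrow> complex \<times> complex \<Rightarrow> complex \<times> complex \<Rightarrow> real) \<Rightarrow> bool"
  where "connection_form \<theta> \<longleftrightarrow> one_form_on F1 F1_regular \<theta> \<and>
    (\<forall>i. \<forall>y \<in> regular_img i. \<theta> i y (circle_gen i y) = 1 \<and>
       (\<forall>v. lie_oneform (circle_gen i) (\<theta> i) y v = 0))"

definition admissible_profile :: "real \<Rightarrow> (real \<Rightarrow> real) \<Rightarrow> bool"
  where "admissible_profile x F \<longleftrightarrow>
    (\<exists>T. open T \<and> {-1..1} \<subseteq> T \<and> smooth_on T F) \<and>
    (\<forall>t \<in> {-1<..<1}. F t > 0) \<and> F (-1) = 0 \<and> F 1 = 0 \<and>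
    (F has_real_derivative 2 * (1 - x)) (at (-1)) \<and>
    (F has_real_derivative - 2 * (1 + x)) (at 1)"

text \<open>
  The complex structure of \<open>F1\<close> is fixed, and \<open>\<zz>\<close>, \<open>\<theta>\<close>, \<open>g\<close> are related to it by
  \<open>J d\<zz> = \<Theta> \<theta>\<close>, where \<open>J\<alpha> = - \<alpha> \<circ> J\<close> on 1-forms. Further conventions are
  \<open>\<omega> = g(J\<cdot>, \<cdot>)\<close> and \<open>(\<alpha> \<and> \<beta>)(u, v) = \<alpha>(u) \<beta>(v) - \<alpha>(v) \<beta>(u)\<close>.
\<close>

definition admissible_metric ::
  "real \<Rightarrow> (base_chart \<Rightarrow> complex metric_field) \<Rightarrow> (f1 \<Rightarrow> real)
    \<Rightarrow> (base_chart \<times> fibre_chart \<Rightarrow> complex \<times> complex \<Rightarrow> complex \<times> complex \<Rightarrow> real)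
    \<Rightarrow> (real \<Rightarrow> real) \<Rightarrow> (base_chart \<times> fibre_chart \<Rightarrow> (complex \<times> complex) metric_field) \<Rightarrow> bool"
  where "admissible_metric x gB z \<theta> F g \<longleftrightarrow>
    kaehler_metric CP1 gB \<and> is_scal CP1 gB (\<lambda>_. 4) \<and>
    kaehler_metric F1 g \<and>
    smooth_fun F1 z \<and> range z \<subseteq> {-1..1} \<and>
    {q. z q = 1} = zero_section \<and> {q. z q = -1} = infinity_section \<and>
    (\<forall>i. \<forall>y \<in> Img F1 i. circle_gen i y = Imult F1 (grad (g i) (loc F1 i z) y)) \<and>
    connection_form \<theta> \<and>
    (\<forall>i. \<forall>y \<in> regular_img i. \<forall>u v.
       ext_deriv1 (\<theta> i) y u v = pullback_base (kaehler_form CP1 gB) i y u v) \<and>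
    admissible_profile x F \<and>
    (\<forall>i. \<forall>y \<in> regular_img i.
       let Z = loc F1 i z y; dz = dir_deriv (loc F1 i z) y; \<Theta> = F Z / (1 + x * Z) in
       (\<forall>v. - dz (Imult F1 v) = \<Theta> * \<theta> i y v) \<and>
       (\<forall>u v. g i y u v = (1 + x * Z) / x * pullback_base gB i y u v
                + dz u * dz v / \<Theta> + \<Theta> * \<theta> i y u * \<theta> i y v) \<and>
       (\<forall>u v. kaehler_form F1 g i y u v =
                (1 + x * Z) / x * pullback_base (kaehler_form CP1 gB) i y u v
                + (dz u * \<theta> i y v - dz v * \<theta> i y u)))"

text \<open>
  Calabi's metric with parameter \<open>x\<close>, together with its moment map: the profile \<open>F\<close> is the one
  for which the admissible metric is extremal.
\<close>

definition calabi_metric ::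
  "real \<Rightarrow> (f1 \<Rightarrow> real) \<Rightarrow> (base_chart \<times> fibre_chart \<Rightarrow> (complex \<times> complex) metric_field) \<Rightarrow> bool"
  where "calabi_metric x z g \<longleftrightarrow> (\<exists>gB \<theta> F. admissible_metric x gB z \<theta> F g) \<and> extremal F1 g"

end

theory Submission
  imports Defs
begin

text \<open>
  In holomorphic coordinates the trace \<open>\<tau>(u) = tr \<Gamma>(\<cdot>, u)\<close> of the Christoffel symbols of a Kaehler metric
  is the differential of the logarithm of the Hermitian determinant, and the scalar curvature is
  \<open>- tr\<^sub>g D\<tau>\<close>. For an admissible metric the determinant is
  \<open>h(w) F(\<zz>) / (x |v|\<^sup>2)\<close>, with \<open>h\<close> the density of the base metric and \<open>v\<close> the fibre coordinate, which
  gives \<open>Scal = (4x - F'') / (1 + x\<zz>)\<close>, \<open>\<Delta>\<zz> = - F' / (1 + x\<zz>)\<close> and \<open>|d\<zz>|\<^sup>2 = F / (1 + x\<zz>)\<close>.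
  A function of \<open>\<zz>\<close> is a Killing potential only if it is affine in \<open>\<zz>\<close>, so extremality makes \<open>F\<close> a
  polynomial, namely \<open>F = (1 - \<zz>\<^sup>2)(1 + x\<zz>) - k (1 - \<zz>\<^sup>2)\<^sup>2\<close> with \<open>k (3 - x\<^sup>2) = (1 - x) x\<^sup>2\<close>. For
  \<open>f = b\<zz> + 1\<close> the product of \<open>1 + x\<zz>\<close> and the weighted scalar curvature is then a quadratic
  polynomial in \<open>\<zz>\<close>; the condition that \<open>1 + x\<zz>\<close> divides it is satisfied by the given \<open>b\<close>.
\<close>

section \<open>Levi-Civita connection in a chart\<close>

lemma Ck_on_SucD:
  assumes "Ck_on (Suc k) UNIV f"
  shows "f differentiable (at x)" "Ck_on k UNIV (\<lambda>x. dir_deriv f x v)"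
  using assms by (auto simp: differentiable_on_def)

lemma dir_deriv_eqI: "(f has_derivative f') (at x) \<Longrightarrow> dir_deriv f x v = f' v"
  using frechet_derivative_at by metis

lemma dir_deriv_linear:
  "f differentiable (at x) \<Longrightarrow> linear (dir_deriv f x)"
  by (rule linear_frechet_derivative)

lemma has_dir_deriv: "f differentiable (at x) \<Longrightarrow> (f has_derivative dir_deriv f x) (at x)"
  by (simp add: frechet_derivative_works)

text \<open>A differentiable \<open>r\<close> vanishing at \<open>x\<close> is of order
  \<open>norm (y - x)\<close>, so a factor tending to 0 makes \<open>E\<close> of smaller order.
  This disposes of the error term when a linear system is differentiated.\<close>

lemma has_derivative_zeroI:
  fixes E :: "'e::real_normed_vector \<Rightarrow> 'f::real_normed_vector"
  assumes r: "r differentiable (at x)" "r x = 0" and \<kappa>: "(\<kappa> \<longlongrightarrow> 0) (at x)"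
    and E: "\<forall>\<^sub>F y in at x. norm (E y) \<le> \<kappa> y * norm (r y)" "E x = 0"
  shows "(E has_derivative (\<lambda>_. 0)) (at x)"
  unfolding has_derivative_within_alt2
proof (intro conjI allI impI)
  show "bounded_linear (\<lambda>_::'e. 0::'f)" by simp
  fix e :: real assume "e > 0"
  obtain r' where r': "(r has_derivative r') (at x)" using r(1) by (auto simp: differentiable_def)
  then obtain C where C: "C > 0" "\<And>h. norm (r' h) \<le> norm h * C"
    using bounded_linear.pos_bounded[OF has_derivative_bounded_linear] by blast
  have "\<forall>\<^sub>F y in at x. norm (r y - r x - r' (y - x)) \<le> 1 * norm (y - x)"
    using r' unfolding has_derivative_within_alt2 using zero_less_one by blast
  moreover have "\<forall>\<^sub>F y in at x. \<bar>\<kappa> y\<bar> < e / (C + 1)"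
    using tendstoD[OF \<kappa>, of "e / (C + 1)"] \<open>e > 0\<close> C by simp
  ultimately show "\<forall>\<^sub>F y in at x. norm (E y - E x - 0) \<le> e * norm (y - x)"
    using E(1)
  proof eventually_elim
    case (elim y)
    have "norm (r y) \<le> norm (r' (y - x)) + norm (r y - r' (y - x))"
      using norm_triangle_ineq[of "r' (y - x)" "r y - r' (y - x)"] by simp
    also have "\<dots> \<le> (C + 1) * norm (y - x)"
      using elim(1) C(2)[of "y - x"] r(2) by (simp add: algebra_simps)
    finally have 1: "norm (r y) \<le> (C + 1) * norm (y - x)" .
    have "norm (E y) \<le> \<bar>\<kappa> y\<bar> * norm (r y)"
      using elim(3) by (smt (verit) mult_right_mono norm_ge_zero)
    also have "\<dots> \<le> e / (C + 1) * ((C + 1) * norm (y - x))"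
      using elim(2) 1 by (intro mult_mono) auto
    also have "\<dots> = e * norm (y - x)" using C by simp
    finally show ?case using E(2) by simp
  qed
qed

lemma linear_expand:
  fixes \<alpha> :: "'e::euclidean_space \<Rightarrow> real"
  assumes "linear \<alpha>"
  shows "\<alpha> v = (\<Sum>e\<in>Basis. (v \<bullet> e) * \<alpha> e)"
proof -
  have "\<alpha> v = \<alpha> (\<Sum>e\<in>Basis. (v \<bullet> e) *\<^sub>R e)" by (simp add: euclidean_representation)
  then show ?thesis using assms by (simp add: linear_sum linear_cmul)
qed

lemma linear_inner_Basis:
  fixes \<alpha> :: "'e::euclidean_space \<Rightarrow> real"
  assumes "linear \<alpha>"
  shows "(\<Sum>e\<in>Basis. \<alpha> e *\<^sub>R e) \<bullet> v = \<alpha> v"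
  by (subst linear_expand[OF assms, of v])
    (simp add: inner_sum_right inner_commute mult.commute)

section \<open>Raising and lowering indices in a chart\<close>

text \<open>Every chart of the two atlases is onto, so the hypotheses hold at all \<open>y\<close>
  and no domain has to be tracked. Curvature takes two derivatives of the metric, hence
  \<open>C2\<close>.\<close>

locale riemannian_chart =
  fixes g :: "'e::euclidean_space metric_field"
  assumes bil: "bilinear (g y)" and sym: "g y u v = g y v u"
    and pos: "u \<noteq> 0 \<Longrightarrow> g y u u > 0"
    and C2: "Ck_on 2 UNIV (\<lambda>y. g y u v)"
begin

lemma linear_g: "linear (g y u)" "linear (\<lambda>u. g y u v)"
  using bil[of y] by (auto simp: bilinear_def)

lemmas g_linear [simp] =
  linear_add[OF linear_g(1)] linear_cmul[OF linear_g(1)] linear_0[OF linear_g(1)]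
  linear_diff[OF linear_g(1)] linear_neg[OF linear_g(1)]
  linear_add[OF linear_g(2)] linear_cmul[OF linear_g(2)] linear_0[OF linear_g(2)]
  linear_diff[OF linear_g(2)] linear_neg[OF linear_g(2)]

lemma g_differentiable: "(\<lambda>y. g y u v) differentiable (at x)"
  using Ck_on_SucD(1)[of 1 "\<lambda>y. g y u v"] C2 by (simp add: numeral_2_eq_2)

definition dg :: "'e \<Rightarrow> 'e \<Rightarrow> 'e \<Rightarrow> 'e \<Rightarrow> real"
  where "dg y u v w = dir_deriv (\<lambda>y. g y v w) y u"

lemma has_derivative_g: "((\<lambda>y. g y v w) has_derivative (\<lambda>u. dg x u v w)) (at x)"
  using has_dir_deriv[OF g_differentiable] by (simp add: dg_def)

lemma dg_differentiable: "(\<lambda>y. dg y u v w) differentiable (at x)"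
proof -
  have "Ck_on 1 UNIV (\<lambda>y. dg y u v w)"
    using Ck_on_SucD(2)[of 1 "\<lambda>y. g y v w" u] C2 by (simp add: numeral_2_eq_2 dg_def)
  then show ?thesis unfolding One_nat_def by (rule Ck_on_SucD(1))
qed

lemma dg_sym: "dg y u v w = dg y u w v"
  unfolding dg_def by (subst sym) simp

lemma dg_linear1: "linear (\<lambda>u. dg y u v w)"
  unfolding dg_def by (rule dir_deriv_linear[OF g_differentiable])

lemma dg_linear3: "linear (\<lambda>w. dg y u v w)"
proof (rule linearI)
  fix a b c
  show "dg y u v (a + b) = dg y u v a + dg y u v b"
    unfolding dg_def[of y u v "a + b"]
    by (rule dir_deriv_eqI) (auto intro!: derivative_eq_intros has_derivative_g)
  show "dg y u v (c *\<^sub>R a) = c *\<^sub>R dg y u v a"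
    unfolding dg_def[of y u v "c *\<^sub>R a"]
    by (rule dir_deriv_eqI) (auto intro!: derivative_eq_intros has_derivative_g)
qed

lemma dg_linear2: "linear (\<lambda>v. dg y u v w)"
  using dg_linear3[of y u w] by (simp add: dg_sym[of _ _ w])

lemmas dg_simps [simp] =
  linear_add[OF dg_linear1] linear_cmul[OF dg_linear1] linear_0[OF dg_linear1]
  linear_diff[OF dg_linear1] linear_neg[OF dg_linear1]
  linear_add[OF dg_linear2] linear_cmul[OF dg_linear2] linear_0[OF dg_linear2]
  linear_diff[OF dg_linear2] linear_neg[OF dg_linear2]
  linear_add[OF dg_linear3] linear_cmul[OF dg_linear3] linear_0[OF dg_linear3]
  linear_diff[OF dg_linear3] linear_neg[OF dg_linear3]

lemma g_eqI:
  assumes "\<And>w. g y u w = g y v w"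
  shows "u = v"
  using pos[of "u - v" y] assms[of "u - v"] by fastforce

text \<open>The lowered covector is encoded as a vector through the Euclidean product, so that
  "injective implies surjective" for endomorphisms yields existence in \<open>sharp\<close>.\<close>

definition flat :: "'e \<Rightarrow> 'e \<Rightarrow> 'e"
  where "flat y u = (\<Sum>e\<in>Basis. g y u e *\<^sub>R e)"

lemma flat_inner: "flat y u \<bullet> v = g y u v"
  unfolding flat_def by (rule linear_inner_Basis[OF linear_g(1)])

lemma linear_flat: "linear (flat y)"
  by (rule linearI; rule euclidean_eqI; simp add: flat_inner inner_add_left)

lemma inj_flat: "inj (flat y)"
  by (rule injI, rule g_eqI[of y]) (metis flat_inner)

lemma sharp_unique:
  assumes "\<And>v. g y X v = \<alpha> v"
  shows "sharp g y \<alpha> = X"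
  unfolding sharp_def
  by (rule the_equality) (auto simp: assms intro!: g_eqI[of y])

lemma sharp_works:
  assumes "linear \<alpha>"
  shows "g y (sharp g y \<alpha>) v = \<alpha> v"
proof -
  have "surj (flat y)" using linear_injective_imp_surjective[OF linear_flat inj_flat] by simp
  then obtain X where "flat y X = (\<Sum>e\<in>Basis. \<alpha> e *\<^sub>R e)" by (metis surjD)
  then have X: "g y X v = \<alpha> v" for v
    using linear_inner_Basis[OF assms, of v] flat_inner by metis
  from sharp_unique[OF this] X show ?thesis by simp
qed

text \<open>Differentiates the solution of a linear system without inverse matrices. With
  \<open>H\<close> inverting \<open>flat x\<close>, one has
  \<open>X y = X x + H (r y) - E y\<close>, where \<open>r\<close> is visibly differentiable and
  \<open>E\<close> has derivative 0, because \<open>flat y - flat x\<close> tends to 0 and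
  \<open>X y - X x\<close> is bounded by a multiple of \<open>r y\<close>.\<close>

lemma sharp_differentiable:
  assumes lin: "\<And>y. linear (\<alpha> y)" and diff: "\<And>v. (\<lambda>y. \<alpha> y v) differentiable (at x)"
  shows "(\<lambda>y. sharp g y (\<alpha> y)) differentiable (at x)"
proof -
  define X where "X y = sharp g y (\<alpha> y)" for y
  define r where "r y = (\<Sum>e\<in>Basis. (\<alpha> y e - g y (X x) e) *\<^sub>R e)" for y
  \<comment> \<open>The entrywise distance between the matrices of \<open>g y\<close> and
    \<open>g x\<close>, which dominates the operator norm of \<open>flat y - flat x\<close>.\<close>
  define \<kappa> where "\<kappa> y = (\<Sum>i\<in>Basis. \<Sum>e\<in>Basis. \<bar>g y i e - g x i e\<bar>)" for y
  have g_X: "g y (X y) v = \<alpha> y v" for y v unfolding X_def by (rule sharp_works[OF lin])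
  obtain H where H: "linear H" "\<And>u. H (flat x u) = u"
    using linear_injective_left_inverse[OF linear_flat inj_flat, of x] by (metis comp_eq_dest_lhs id_apply)
  obtain B where B: "B > 0" "\<And>u. B * norm u \<le> norm (flat x u)"
    using linear_inj_bounded_below_pos[OF linear_flat inj_flat] by blast
  obtain C where C: "C > 0" "\<And>u. norm (H u) \<le> C * norm u"
    using linear_bounded_pos[OF H(1)] by blast
  have \<kappa>_bound: "norm (flat y u - flat x u) \<le> \<kappa> y * norm u" for y u
  proof -
    have gu: "g z u e = (\<Sum>i\<in>Basis. (u \<bullet> i) * g z i e)" for z e
      by (rule linear_expand[OF linear_g(2)])
    have "norm (flat y u - flat x u) \<le> (\<Sum>e\<in>Basis. \<bar>(flat y u - flat x u) \<bullet> e\<bar>)"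
      by (rule norm_le_l1)
    also have "\<dots> = (\<Sum>e\<in>Basis. \<bar>\<Sum>i\<in>Basis. (u \<bullet> i) * (g y i e - g x i e)\<bar>)"
      by (simp add: flat_inner inner_diff_left gu sum_subtractf right_diff_distrib)
    also have "\<dots> \<le> (\<Sum>e\<in>Basis. \<Sum>i\<in>Basis. norm u * \<bar>g y i e - g x i e\<bar>)"
      by (intro sum_mono order.trans[OF sum_abs])
        (auto simp: abs_mult Basis_le_norm intro!: mult_right_mono)
    also have "\<dots> = \<kappa> y * norm u"
      unfolding \<kappa>_def by (subst sum.swap) (simp add: sum_distrib_left mult.commute)
    finally show ?thesis .
  qed
  have key: "flat x (X y - X x) = r y - (flat y (X y - X x) - flat x (X y - X x))" for y
    by (rule euclidean_eqI) (simp add: flat_inner r_def inner_diff_left g_X)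
  have g_cont: "((\<lambda>y. g y i e) \<longlongrightarrow> g x i e) (at x)" for i e
    using differentiable_imp_continuous_within[OF g_differentiable, of x i e]
    by (simp add: continuous_within)
  have \<kappa>_lim: "(\<kappa> \<longlongrightarrow> 0) (at x)"
    unfolding \<kappa>_def using g_cont by (auto intro!: tendsto_eq_intros)
  have r_diff: "r differentiable (at x)"
    unfolding r_def by (intro differentiable_sum ballI differentiable_scaleR differentiable_diff differentiable_const diff g_differentiable) auto
  have rx: "r x = 0" by (simp add: r_def g_X)
  define E where "E y = H (flat y (X y - X x) - flat x (X y - X x))" for y
  have "\<forall>\<^sub>F y in at x. \<bar>\<kappa> y\<bar> < B / 2" using tendstoD[OF \<kappa>_lim, of "B / 2"] B by simp
  \<comment> \<open>Since \<kappa> stays below \<open>B / 2\<close>, the perturbation absorbs at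
    most half of the lower bound \<open>B\<close> for \<open>flat x\<close>; hence the factor
    \<open>2 / B\<close>.\<close>
  then have E_bound: "\<forall>\<^sub>F y in at x. norm (E y) \<le> (2 * C / B * \<kappa> y) * norm (r y)"
  proof eventually_elim
    case (elim y)
    have \<kappa>0: "\<kappa> y \<ge> 0" unfolding \<kappa>_def by (intro sum_nonneg) auto
    have "B * norm (X y - X x) \<le> norm (r y) + \<kappa> y * norm (X y - X x)"
      using B(2)[of "X y - X x"] \<kappa>_bound[of y "X y - X x"] arg_cong[OF key[of y], of norm]
        norm_triangle_ineq4[of "r y" "flat y (X y - X x) - flat x (X y - X x)"] by linarith
    also have "\<dots> \<le> norm (r y) + B / 2 * norm (X y - X x)"
      using elim by (intro add_left_mono mult_right_mono) auto
    finally have 1: "norm (X y - X x) \<le> 2 / B * norm (r y)" using B(1) by (simp add: field_simps)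
    have "norm (E y) \<le> C * (\<kappa> y * norm (X y - X x))"
      unfolding E_def using C \<kappa>_bound[of y "X y - X x"] by (meson mult_left_mono order.trans less_imp_le)
    also have "\<dots> \<le> C * (\<kappa> y * (2 / B * norm (r y)))"
      using 1 \<kappa>0 C(1) by (intro mult_left_mono) auto
    finally show ?case by (simp add: algebra_simps)
  qed
  have E: "(E has_derivative (\<lambda>_. 0)) (at x)"
    by (rule has_derivative_zeroI[OF r_diff rx _ E_bound])
      (use \<kappa>_lim B(1) in \<open>auto simp: E_def linear_0[OF H(1)] intro!: tendsto_eq_intros\<close>)
  have "X y = X x + H (r y) - E y" for y
  proof -
    have "X y - X x = H (r y - (flat y (X y - X x) - flat x (X y - X x)))"
      using H(2)[of "X y - X x"] key[of y] by simp
    then show ?thesis by (simp add: E_def linear_diff[OF H(1)] linear_add[OF H(1)] algebra_simps)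
  qed
  then have X_eq: "X = (\<lambda>y. X x + H (r y) - E y)" by (rule ext)
  have "X differentiable (at x)"
    by (subst X_eq)
      (intro differentiable_diff differentiable_add differentiable_const differentiableI[OF E]
        differentiable_compose[OF linear_imp_differentiable[OF H(1)] r_diff])
  then show ?thesis by (simp add: X_def[abs_def])
qed

end

text \<open>A Euclidean trace may be computed in any orthonormal basis: expand both slots in
  \<open>Basis\<close> and use that \<open>J i\<close> and \<open>J j\<close> have the same product
  as \<open>i\<close> and \<open>j\<close>.\<close>

lemma orthogonal_sum_Basis:
  fixes B :: "'e::euclidean_space \<Rightarrow> 'e \<Rightarrow> real"
  assumes B: "bilinear B" and J: "linear J" "\<And>v. J (J v) = - v" "\<And>u v. J u \<bullet> J v = u \<bullet> v"
  shows "(\<Sum>e\<in>Basis. B (J e) (J e)) = (\<Sum>e\<in>Basis. B e e)"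
proof -
  have lin: "linear (B u)" "linear (\<lambda>u. B u v)" for u v using B by (auto simp: bilinear_def)
  have adj: "J u \<bullet> v = - (u \<bullet> J v)" for u v
    using J(3)[of u "J v"] by (simp add: J(2))
  have expand: "B (J e) (J e) = (\<Sum>i\<in>Basis. \<Sum>j\<in>Basis. (J i \<bullet> e) * (J j \<bullet> e) * B i j)" for e
  proof -
    have "B (J e) (J e) = (\<Sum>i\<in>Basis. (J e \<bullet> i) * B i (J e))"
      by (rule linear_expand[OF lin(2)])
    also have "\<dots> = (\<Sum>i\<in>Basis. (J e \<bullet> i) * (\<Sum>j\<in>Basis. (J e \<bullet> j) * B i j))"
      by (subst linear_expand[OF lin(1), of _ "J e"]) simp
    also have "\<dots> = (\<Sum>i\<in>Basis. \<Sum>j\<in>Basis. (J e \<bullet> i) * (J e \<bullet> j) * B i j)"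
      by (simp add: sum_distrib_left mult.assoc)
    also have "\<dots> = (\<Sum>i\<in>Basis. \<Sum>j\<in>Basis. (J i \<bullet> e) * (J j \<bullet> e) * B i j)"
      using adj[of e] by (simp add: inner_commute[of e])
    finally show ?thesis .
  qed
  have "(\<Sum>e\<in>Basis. B (J e) (J e)) = (\<Sum>i\<in>Basis. \<Sum>j\<in>Basis. \<Sum>e\<in>Basis. (J i \<bullet> e) * (J j \<bullet> e) * B i j)"
    unfolding expand by (subst sum.swap) (rule sum.cong[OF refl], rule sum.swap)
  also have "\<dots> = (\<Sum>i\<in>Basis. \<Sum>j\<in>Basis. (i \<bullet> j) * B i j)"
    by (simp add: sum_distrib_right[symmetric] euclidean_inner[symmetric] J(3))
  also have "\<dots> = (\<Sum>e\<in>Basis. B e e)"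
    by (intro sum.cong refl) (simp add: inner_Basis if_distrib[of "\<lambda>x. x * _"] cong: if_cong)
  finally show ?thesis .
qed

section \<open>Christoffel symbols, their trace and the Ricci tensor\<close>

context riemannian_chart
begin

abbreviation \<Gamma> :: "'e \<Rightarrow> 'e \<Rightarrow> 'e \<Rightarrow> 'e" where "\<Gamma> \<equiv> christoffel g"

lemma koszul: "g y (\<Gamma> y u v) w = (dg y u v w + dg y v u w - dg y w u v) / 2"
  unfolding christoffel_def dg_def[symmetric]
  by (rule sharp_works) (rule linearI; simp add: field_simps)

lemma christoffel_sym: "\<Gamma> y u v = \<Gamma> y v u"
  by (rule g_eqI[of y]) (simp add: koszul dg_sym)

lemma linear_christoffel: "linear (\<Gamma> y u)" "linear (\<lambda>u. \<Gamma> y u v)"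
  by (rule linearI; rule g_eqI[of y]; simp add: koszul field_simps)+

lemma christoffel_differentiable: "(\<lambda>y. \<Gamma> y u v) differentiable (at x)"
  unfolding christoffel_def dg_def[symmetric]
proof (rule sharp_differentiable)
  show "linear (\<lambda>w. (dg y u v w + dg y v u w - dg y w u v) / 2)" for y
    by (rule linearI; simp add: field_simps)
  show "(\<lambda>y. (dg y u v w + dg y v u w - dg y w u v) / 2) differentiable at x" for w
    by (intro derivative_intros dg_differentiable) auto
qed

lemma metric_compatible: "dg y e u v = g y (\<Gamma> y e u) v + g y u (\<Gamma> y e v)"
  using koszul[of y e u v] koszul[of y e v u] sym[of y u "\<Gamma> y e v"] dg_sym[of y e v u]
  by (simp add: field_simps)

text \<open>A row of the inverse matrix of \<open>g y\<close>, as in \<open>scal\<close>; traces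
  with respect to \<open>g\<close> become sums of \<open>B e (dual y e)\<close>.\<close>

definition dual :: "'e \<Rightarrow> 'e \<Rightarrow> 'e"
  where "dual y e = sharp g y (\<lambda>v. e \<bullet> v)"

lemma g_dual: "g y (dual y e) v = e \<bullet> v"
  unfolding dual_def by (rule sharp_works) (simp add: bounded_linear.linear bounded_linear_inner_right)

lemma dual_inner: "g y v (dual y e) = v \<bullet> e"
  by (simp add: sym[of _ v] g_dual inner_commute)

lemma linear_dual: "linear (dual y)"
  by (rule linearI; rule g_eqI[of y]; simp add: g_dual inner_add_left)

lemma dual_sym: "dual y e \<bullet> f = e \<bullet> dual y f"
  using g_dual[of y f "dual y e"] g_dual[of y e "dual y f"]
  by (simp add: sym[of _ "dual y e"] inner_commute)

text \<open>The inverse matrix is symmetric, so it does not matter which slot is raised.\<close>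

lemma sum_dual_swap:
  assumes "bilinear B"
  shows "(\<Sum>e\<in>Basis. B (dual y e) e) = (\<Sum>e\<in>Basis. B e (dual y e) :: real)"
proof -
  have lin: "linear (B u)" "linear (\<lambda>u. B u v)" for u v using assms by (auto simp: bilinear_def)
  have "(\<Sum>e\<in>Basis. B (dual y e) e) = (\<Sum>e\<in>Basis. \<Sum>f\<in>Basis. (dual y e \<bullet> f) * B f e)"
    by (subst linear_expand[OF lin(2)]) simp
  also have "\<dots> = (\<Sum>f\<in>Basis. \<Sum>e\<in>Basis. (dual y f \<bullet> e) * B f e)"
    by (subst sum.swap) (intro sum.cong refl, metis dual_sym inner_commute)
  also have "\<dots> = (\<Sum>e\<in>Basis. B e (dual y e))"
    by (subst linear_expand[OF lin(1), of _ "dual y _"]) simp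
  finally show ?thesis .
qed

definition \<tau> :: "'e \<Rightarrow> 'e \<Rightarrow> real"
  where "\<tau> y u = (\<Sum>e\<in>Basis. \<Gamma> y e u \<bullet> e)"

lemma linear_\<tau>: "linear (\<tau> y)"
  unfolding \<tau>_def
  by (rule linearI) (simp_all add: linear_add[OF linear_christoffel(1)]
    linear_cmul[OF linear_christoffel(1)] inner_add_left sum.distrib sum_distrib_left)

text \<open>In the traced Koszul formula the two terms that differentiate along the traced
  directions cancel by symmetry of the inverse metric.\<close>

lemma \<tau>_eq: "\<tau> y u = (\<Sum>e\<in>Basis. dg y u e (dual y e)) / 2"
proof -
  have "(\<Sum>e\<in>Basis. dg y (dual y e) e u) = (\<Sum>e\<in>Basis. dg y e (dual y e) u)"
    by (rule sum_dual_swap[of "\<lambda>a b. dg y a b u"])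
      (simp add: bilinear_def dg_linear1 dg_linear2)
  moreover have "\<Gamma> y e u \<bullet> e = (dg y e (dual y e) u + dg y u e (dual y e) - dg y (dual y e) e u) / 2" for e
    using koszul[of y e u "dual y e"] by (simp add: dual_inner dg_sym[of y e u "dual y e"])
  ultimately show ?thesis
    by (simp only: \<tau>_def sum_divide_distrib[symmetric] sum.distrib sum_subtractf) simp
qed

lemma \<tau>_differentiable: "(\<lambda>y. \<tau> y u) differentiable (at x)"
  unfolding \<tau>_def using christoffel_differentiable
  by (intro derivative_intros differentiable_inner) auto

lemma divergence_eq: "divergence g X x = (\<Sum>e\<in>Basis. dir_deriv X x e \<bullet> e) + \<tau> x (X x)"
  by (simp add: divergence_def \<tau>_def inner_add_left sum.distrib)

definition d\<Gamma> :: "'e \<Rightarrow> 'e \<Rightarrow> 'e \<Rightarrow> 'e \<Rightarrow> 'e"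
  where "d\<Gamma> y u v w = dir_deriv (\<lambda>y. \<Gamma> y v w) y u"

definition d\<tau> :: "'e \<Rightarrow> 'e \<Rightarrow> 'e \<Rightarrow> real"
  where "d\<tau> y u v = dir_deriv (\<lambda>y. \<tau> y v) y u"

lemma has_derivative_\<Gamma>: "((\<lambda>y. \<Gamma> y v w) has_derivative (\<lambda>u. d\<Gamma> x u v w)) (at x)"
  using has_dir_deriv[OF christoffel_differentiable] by (simp add: d\<Gamma>_def)

lemma d\<Gamma>_linear: "linear (\<lambda>u. d\<Gamma> y u v w)" "linear (\<lambda>v. d\<Gamma> y u v w)" "linear (\<lambda>w. d\<Gamma> y u v w)"
proof -
  note simps = linear_add[OF linear_christoffel(1)] linear_cmul[OF linear_christoffel(1)]
    linear_add[OF linear_christoffel(2)] linear_cmul[OF linear_christoffel(2)]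
  show "linear (\<lambda>u. d\<Gamma> y u v w)"
    unfolding d\<Gamma>_def by (rule dir_deriv_linear[OF christoffel_differentiable])
  show "linear (\<lambda>v. d\<Gamma> y u v w)"
    by (rule linearI; subst d\<Gamma>_def; rule dir_deriv_eqI)
      (auto simp: simps intro!: derivative_eq_intros has_derivative_\<Gamma>)
  show "linear (\<lambda>w. d\<Gamma> y u v w)"
    by (rule linearI; subst d\<Gamma>_def; rule dir_deriv_eqI)
      (auto simp: simps intro!: derivative_eq_intros has_derivative_\<Gamma>)
qed

lemma d\<tau>_eq: "d\<tau> y u v = (\<Sum>e\<in>Basis. d\<Gamma> y u e v \<bullet> e)"
  unfolding d\<tau>_def \<tau>_def
  by (rule dir_deriv_eqI) (auto intro!: derivative_eq_intros has_derivative_\<Gamma>)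

lemma bilinear_d\<tau>: "bilinear (d\<tau> y)"
  unfolding bilinear_def d\<tau>_eq
  by (intro conjI allI; rule linearI)
    (simp_all add: linear_add[OF d\<Gamma>_linear(1)] linear_cmul[OF d\<Gamma>_linear(1)]
      linear_add[OF d\<Gamma>_linear(3)] linear_cmul[OF d\<Gamma>_linear(3)]
      inner_add_left sum.distrib sum_distrib_left)

lemma ricci_eq:
  "ricci g y v w = (\<Sum>e\<in>Basis. d\<Gamma> y e v w \<bullet> e) - d\<tau> y v w
     + \<tau> y (\<Gamma> y v w) - (\<Sum>e\<in>Basis. \<Gamma> y v (\<Gamma> y e w) \<bullet> e)"
  by (simp add: ricci_def riemann_def d\<Gamma>_def[symmetric] inner_add_left inner_diff_left
      sum.distrib sum_subtractf d\<tau>_eq \<tau>_def)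

lemma bilinear_ricci: "bilinear (ricci g y)"
  unfolding bilinear_def ricci_eq d\<tau>_eq
  by (intro conjI allI; rule linearI)
    (simp_all add: linear_add[OF d\<Gamma>_linear(1)] linear_cmul[OF d\<Gamma>_linear(1)]
      linear_add[OF d\<Gamma>_linear(2)] linear_cmul[OF d\<Gamma>_linear(2)]
      linear_add[OF d\<Gamma>_linear(3)] linear_cmul[OF d\<Gamma>_linear(3)]
      linear_add[OF linear_christoffel(1)] linear_cmul[OF linear_christoffel(1)]
      linear_add[OF linear_christoffel(2)] linear_cmul[OF linear_christoffel(2)]
      linear_add[OF linear_\<tau>] linear_cmul[OF linear_\<tau>]
      inner_add_left sum.distrib sum_distrib_left algebra_simps)

lemma dir_deriv_metric:
  assumes X: "X differentiable (at x)"
  shows "((\<lambda>y. g y (X y) v) has_derivative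
    (\<lambda>u. dg x u (X x) v + g x (dir_deriv X x u) v)) (at x)"
proof -
  have expand: "g y u v = (\<Sum>i\<in>Basis. (u \<bullet> i) * g y i v)" for y u
    by (rule linear_expand[OF linear_g(2)])
  have expand': "dg y w u v = (\<Sum>i\<in>Basis. (u \<bullet> i) * dg y w i v)" for y u w
    by (rule linear_expand[OF dg_linear2])
  show ?thesis
    unfolding expand[of _ "X _"] expand'[of _ _ "X x"] expand[of _ "dir_deriv X x _"]
    by (auto intro!: derivative_eq_intros has_derivative_g has_dir_deriv[OF X]
        simp: sum.distrib algebra_simps)
qed

end

section \<open>Kaehler identities in a holomorphic chart\<close>

text \<open>\<open>J\<close> is constant because charts are holomorphic. \<open>J_inner\<close>
  concerns the Euclidean product of the coordinates, not \<open>g\<close>; it allows sums over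
  \<open>Basis\<close> to be averaged over \<open>J\<close>.\<close>

locale kaehler_chart = riemannian_chart g
  for g :: "'e::euclidean_space metric_field" +
  fixes J :: "'e \<Rightarrow> 'e"
  assumes linear_J: "linear J" and J_J [simp]: "J (J v) = - v" and J_inner: "J u \<bullet> J v = u \<bullet> v"
    and g_J: "g y (J u) (J v) = g y u v"
    and closed: "ext_deriv2 (\<lambda>y u v. g y (J u) v) y u v w = 0"
begin

lemma g_J_left: "g y (J u) v = - g y u (J v)"
  using g_J[of y u "J v"] by simp

lemma dg_J: "dg y w (J u) (J v) = dg y w u v"
  by (simp add: dg_def g_J)

lemma dg_J_left: "dg y w (J u) v = - dg y w u (J v)"
  using dg_J[of y w u "J v"] by simp

lemma closed': "dg y u (J v) w + dg y v (J w) u + dg y w (J u) v = 0"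
  using closed[of y u v w] by (simp add: ext_deriv2_def dg_def)

text \<open>This is the parallelism of the complex structure, written for constant
  \<open>J\<close>.\<close>

lemma christoffel_J: "\<Gamma> y u (J v) = J (\<Gamma> y u v)"
proof (rule g_eqI[of y])
  fix w
  \<comment> \<open>Closedness on (J v, J w, u) and on (v, w, u): by \<open>J\<close>-invariance of
    \<open>dg\<close>, the second relation minus the first is twice the difference of the two
    sides.\<close>
  have "dg y (J v) (J (J w)) u + dg y (J w) (J u) (J v) + dg y u (J (J v)) (J w) = 0"
    by (rule closed')
  moreover have "dg y v (J w) u + dg y w (J u) v + dg y u (J v) w = 0"
    by (rule closed')
  ultimately show "g y (\<Gamma> y u (J v)) w = g y (J (\<Gamma> y u v)) w"
    using dg_sym[of y "J v" w u] dg_sym[of y v "J w" u] dg_J_left[of y u v w]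
    by (simp add: g_J_left koszul dg_J dg_J_left field_simps)
qed

lemma christoffel_J': "\<Gamma> y (J u) v = J (\<Gamma> y u v)"
  using christoffel_J[of y v u] by (simp add: christoffel_sym)

lemma dual_J: "dual y (J e) = J (dual y e)"
proof (rule g_eqI[of y])
  show "g y (dual y (J e)) w = g y (J (dual y e)) w" for w
    using J_inner[of e "J w"] by (simp add: g_dual g_J_left)
qed

text \<open>\<open>dual\<close> commutes with \<open>J\<close>, so the Euclidean invariance applies
  to \<open>B u (dual y v)\<close>.\<close>

lemma sum_dual_J:
  assumes "bilinear B"
  shows "(\<Sum>e\<in>Basis. B (J e) (J (dual y e))) = (\<Sum>e\<in>Basis. B e (dual y e) :: real)"
proof -
  have "bilinear (\<lambda>u v. B u (dual y v))"
    using assms by (auto simp: bilinear_def intro: linear_compose[OF linear_dual, unfolded o_def])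
  from orthogonal_sum_Basis[OF this linear_J J_J J_inner] show ?thesis by (simp add: dual_J)
qed

text \<open>Every term of \<open>ricci_eq\<close> except the one in \<open>d\<tau>\<close> is built
  from Christoffel symbols in a way complex bilinear in \<open>v\<close> and \<open>w\<close>, so it
  changes sign when \<open>J\<close> is applied to both.\<close>

lemma ricci_J: "ricci g y v w + ricci g y (J v) (J w) = - d\<tau> y v w - d\<tau> y (J v) (J w)"
proof -
  have "d\<Gamma> y e (J v) (J w) = - d\<Gamma> y e v w" for e
    unfolding d\<Gamma>_def[of y e "J v"]
    by (rule dir_deriv_eqI) (auto simp: christoffel_J christoffel_J' intro!: derivative_eq_intros has_derivative_\<Gamma>)
  moreover have "\<Gamma> y (J v) (\<Gamma> y e (J w)) = - \<Gamma> y v (\<Gamma> y e w)" for e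
    by (simp add: christoffel_J christoffel_J')
  moreover have "\<Gamma> y (J v) (J w) = - \<Gamma> y v w"
    by (simp add: christoffel_J christoffel_J')
  ultimately show ?thesis
    by (simp add: ricci_eq sum_negf linear_neg[OF linear_\<tau>])
qed

text \<open>
  The Ricci form is the complex Hessian of the logarithm of the volume density, whose differential
  is \<open>\<tau>\<close>: averaging over \<open>J\<close> cancels every other term of the Ricci tensor.
\<close>

theorem scal_eq: "scal g y = - (\<Sum>e\<in>Basis. d\<tau> y e (dual y e))"
proof -
  have "2 * scal g y = (\<Sum>e\<in>Basis. ricci g y e (dual y e)) + (\<Sum>e\<in>Basis. ricci g y (J e) (J (dual y e)))"
    using sum_dual_J[OF bilinear_ricci] by (simp add: scal_def dual_def)
  also have "\<dots> = - (\<Sum>e\<in>Basis. d\<tau> y e (dual y e)) - (\<Sum>e\<in>Basis. d\<tau> y (J e) (J (dual y e)))"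
    by (simp add: sum.distrib[symmetric] ricci_J sum_subtractf sum_negf)
  also have "\<dots> = - 2 * (\<Sum>e\<in>Basis. d\<tau> y e (dual y e))"
    by (simp add: sum_dual_J[OF bilinear_d\<tau>])
  finally show ?thesis by simp
qed

text \<open>Metric compatibility leaves an extra term, the product of \<open>X\<close> with the
  \<open>g\<close>-trace of the Christoffel symbols. It vanishes because these symbols change sign
  under \<open>J\<close> in both slots: holomorphic coordinates are harmonic. Applied to a gradient,
  this turns the divergence into a trace of second derivatives.\<close>

lemma divergence_eq_trace:
  assumes X: "X differentiable (at x)"
  shows "divergence g X x = (\<Sum>e\<in>Basis. dir_deriv (\<lambda>y. g y (X y) (dual x e)) x e)"
proof -
  have "bilinear (\<lambda>u v. g x (X x) (\<Gamma> x u v))"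
    unfolding bilinear_def
    by (intro conjI allI; rule linearI)
      (simp_all add: linear_add[OF linear_christoffel(1)] linear_cmul[OF linear_christoffel(1)]
      linear_add[OF linear_christoffel(2)] linear_cmul[OF linear_christoffel(2)])
  from sum_dual_J[OF this, of x] have harmonic: "(\<Sum>e\<in>Basis. g x (X x) (\<Gamma> x e (dual x e))) = 0"
    by (simp add: christoffel_J christoffel_J' sum_negf)
  show ?thesis
    by (simp add: dir_deriv_eqI[OF dir_deriv_metric[OF X]] metric_compatible sum.distrib
        dual_inner harmonic divergence_eq \<tau>_def)
qed

end

section \<open>Kaehler metrics on the projective line and on the Hirzebruch surface\<close>

lemma kaehler_chartI:
  assumes "kaehler_metric M g" "Img M i = UNIV" "linear (Imult M)"
    "\<And>v. Imult M (Imult M v) = - v" "\<And>u v. Imult M u \<bullet> Imult M v = u \<bullet> v"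
  shows "kaehler_chart (g i) (Imult M)"
proof -
  have "kaehler_form M g i = (\<lambda>y u v. g i y (Imult M u) v)"
    by (intro ext) (simp add: kaehler_form_def)
  moreover have "ext_deriv2 (kaehler_form M g i) y u v w = 0" for y u v w
    using assms(1,2) by (simp add: kaehler_metric_def)
  moreover have "Ck_on k UNIV (\<lambda>y. g i y u v)" for k u v
    using assms(1,2) unfolding kaehler_metric_def riemannian_metric_def smooth_on_def by metis
  moreover have "bilinear (g i y)" "g i y u v = g i y v u" "u \<noteq> 0 \<Longrightarrow> g i y u u > 0"
    "g i y (Imult M u) (Imult M v) = g i y u v" for y u v
    using assms(1,2) unfolding kaehler_metric_def riemannian_metric_def by (metis UNIV_I)+
  ultimately show ?thesis
    by unfold_locales (simp_all add: assms linear_add[OF assms(3)] linear_cmul[OF assms(3)])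
qed

lemma sum_Basis_complex: "(\<Sum>e\<in>Basis. f e) = f 1 + f \<i>"
  by (simp add: Basis_complex_def)

lemma complex_linear_expand: "linear \<alpha> \<Longrightarrow> \<alpha> u = Re u * \<alpha> 1 + Im u * (\<alpha> \<i> :: real)"
  by (subst linear_expand) (auto simp: sum_Basis_complex)

lemma kaehler_chart_CP1: "kaehler_metric CP1 gB \<Longrightarrow> kaehler_chart (gB i) ((*) \<i>)"
  using kaehler_chartI[OF _ Img_CP1, of gB i]
  by (simp add: CP1_def[THEN arg_cong[of _ _ Imult]] linear_times inner_complex_def)

section \<open>Complex dimension one: the conformal factor\<close>

locale conformal_chart = kaehler_chart g "(*) \<i>" for g :: "complex metric_field"
begin

text \<open>\<open>J\<close>-invariance makes 1 and \<i> orthogonal and equally long.\<close>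

lemma conformal: "g y u v = g y 1 1 * (u \<bullet> v)"
proof -
  have "g y \<i> \<i> = g y 1 1" using g_J[of y 1 1] by simp
  moreover have "g y 1 \<i> = 0" using g_J[of y 1 \<i>] sym[of y 1 \<i>] by simp
  ultimately show ?thesis
    by (subst complex_linear_expand[OF linear_g(2)])
      (simp add: complex_linear_expand[OF linear_g(1), of _ _ v] sym[of y \<i> 1]
        inner_complex_def algebra_simps)
qed

lemma dual_conformal: "dual y e = (1 / g y 1 1) *\<^sub>R e"
  unfolding dual_def
  by (rule sharp_unique) (use pos[of 1 y] in \<open>simp add: conformal[of y e]\<close>)

lemma \<tau>_conformal: "\<tau> y u = dg y u 1 1 / g y 1 1"
  using dg_J[of y u 1 1] by (simp add: \<tau>_eq sum_Basis_complex dual_conformal field_simps)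

text \<open>By \<open>\<tau>_conformal\<close>, \<open>\<tau>\<close> is the differential of the
  logarithm of the conformal factor; this is the Gauss curvature equation for that factor.\<close>

lemma scal_conformal: "d\<tau> y 1 1 + d\<tau> y \<i> \<i> = - (g y 1 1 * scal g y)"
  using bilinear_d\<tau>[of y] pos[of 1 y]
  by (simp add: scal_eq sum_Basis_complex dual_conformal bilinear_rmul field_simps)

end

definition i_mult :: "complex \<times> complex \<Rightarrow> complex \<times> complex"
  where "i_mult v = (\<i> * fst v, \<i> * snd v)"

lemma Imult_F1: "Imult F1 = i_mult"
  by (auto simp: F1_def i_mult_def)

lemma i_mult_simps [simp]:
  "i_mult (a, b) = (\<i> * a, \<i> * b)" "fst (i_mult v) = \<i> * fst v" "snd (i_mult v) = \<i> * snd v"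
  "i_mult (i_mult v) = - v"
  by (simp_all add: i_mult_def prod_eq_iff)

lemma linear_i_mult: "linear i_mult"
  by (rule linearI) (simp_all add: i_mult_def algebra_simps)

lemma kaehler_chart_F1: "kaehler_metric F1 g \<Longrightarrow> kaehler_chart (g i) i_mult"
  using kaehler_chartI[OF _ Img_F1, of g i]
  by (simp add: Imult_F1 linear_i_mult inner_prod_def inner_complex_def)

lemma sum_Basis_complex2:
  "(\<Sum>e\<in>(Basis :: (complex \<times> complex) set). f e) = f (1, 0) + f (\<i>, 0) + (f (0, 1) + f (0, \<i>))"
proof -
  have B: "(Basis :: (complex \<times> complex) set) = {(1, 0), (\<i>, 0), (0, 1), (0, \<i>)}"
    by (auto simp: Basis_prod_def Basis_complex_def)
  show ?thesis unfolding B by (simp add: add.assoc)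
qed

lemma complex2_linear_expand:
  assumes "linear \<alpha>"
  shows "\<alpha> u = Re (fst u) * \<alpha> (1, 0) + Im (fst u) * \<alpha> (\<i>, 0)
    + (Re (snd u) * \<alpha> (0, 1) + Im (snd u) * (\<alpha> (0, \<i>) :: real))"
  by (subst linear_expand[OF assms]) (simp add: sum_Basis_complex2 inner_prod_def)

section \<open>Complex dimension two: the Hermitian determinant\<close>

locale kaehler_surface_chart = kaehler_chart g i_mult for g :: "(complex \<times> complex) metric_field"
begin

text \<open>The determinant of the Hermitian 2 by 2 matrix of \<open>g\<close>; up to sign, the last
  two squared entries are the real and imaginary parts of its off-diagonal entry.\<close>

definition hdet :: "complex \<times> complex \<Rightarrow> real"
  where "hdet y = g y (1, 0) (1, 0) * g y (0, 1) (0, 1) - (g y (1, 0) (0, 1))\<^sup>2 - (g y (1, 0) (0, \<i>))\<^sup>2"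

lemma g_basis:
  "g y (\<i>, 0) (\<i>, 0) = g y (1, 0) (1, 0)" "g y (1, 0) (\<i>, 0) = 0" "g y (\<i>, 0) (1, 0) = 0"
  "g y (\<i>, 0) (0, 1) = - g y (1, 0) (0, \<i>)" "g y (\<i>, 0) (0, \<i>) = g y (1, 0) (0, 1)"
  "g y (0, \<i>) (0, \<i>) = g y (0, 1) (0, 1)" "g y (0, 1) (0, \<i>) = 0" "g y (0, \<i>) (0, 1) = 0"
  "g y (0, 1) (1, 0) = g y (1, 0) (0, 1)" "g y (0, 1) (\<i>, 0) = - g y (1, 0) (0, \<i>)"
  "g y (0, \<i>) (1, 0) = g y (1, 0) (0, \<i>)" "g y (0, \<i>) (\<i>, 0) = g y (1, 0) (0, 1)"
proof -
  have neg: "g y u (-1, 0) = - g y u (1, 0)" "g y u (0, -1) = - g y u (0, 1)"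
    "g y (-1, 0) u = - g y (1, 0) u" "g y (0, -1) u = - g y (0, 1) u" for u
    using linear_neg[OF linear_g(1), of y u "(1, 0)"] linear_neg[OF linear_g(1), of y u "(0, 1)"]
      linear_neg[OF linear_g(2), of y "(1, 0)" u] linear_neg[OF linear_g(2), of y "(0, 1)" u] by simp_all
  show 1: "g y (\<i>, 0) (\<i>, 0) = g y (1, 0) (1, 0)" "g y (0, \<i>) (0, \<i>) = g y (0, 1) (0, 1)"
    "g y (\<i>, 0) (0, \<i>) = g y (1, 0) (0, 1)"
    using g_J[of y "(1, 0)" "(1, 0)"] g_J[of y "(0, 1)" "(0, 1)"] g_J[of y "(1, 0)" "(0, 1)"] by simp_all
  show 2: "g y (1, 0) (\<i>, 0) = 0" "g y (0, 1) (0, \<i>) = 0" "g y (\<i>, 0) (0, 1) = - g y (1, 0) (0, \<i>)"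
    using g_J[of y "(1, 0)" "(\<i>, 0)"] g_J[of y "(0, 1)" "(0, \<i>)"] g_J[of y "(1, 0)" "(0, \<i>)"]
      sym[of y "(1, 0)" "(\<i>, 0)"] sym[of y "(0, 1)" "(0, \<i>)"] by (simp_all add: neg)
  show "g y (\<i>, 0) (1, 0) = 0" "g y (0, \<i>) (0, 1) = 0"
    "g y (0, 1) (1, 0) = g y (1, 0) (0, 1)" "g y (0, 1) (\<i>, 0) = - g y (1, 0) (0, \<i>)"
    "g y (0, \<i>) (1, 0) = g y (1, 0) (0, \<i>)" "g y (0, \<i>) (\<i>, 0) = g y (1, 0) (0, 1)"
    using 1 2 sym by metis+
qed

lemma hdet_pos: "hdet y > 0"
proof -
  \<comment> \<open>A multiple of the component of \<open>(1, 0)\<close> that is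
    \<open>g\<close>-orthogonal to the second coordinate line.\<close>
  define u :: "complex \<times> complex" where "u = g y (0, 1) (0, 1) *\<^sub>R (1, 0)
    + (- g y (1, 0) (0, 1)) *\<^sub>R (0, 1) + (- g y (1, 0) (0, \<i>)) *\<^sub>R (0, \<i>)"
  have d: "g y (0, 1) (0, 1) > 0" by (rule pos) (simp add: zero_prod_def)
  then have "fst u \<noteq> 0" by (simp add: u_def)
  then have "g y u u > 0" by (intro pos) auto
  moreover have "g y u u = g y (0, 1) (0, 1) * hdet y"
    unfolding u_def hdet_def g_linear by (simp add: g_basis power2_eq_square algebra_simps)
  ultimately show ?thesis using d by (simp add: zero_less_mult_iff)
qed

text \<open>Cramer's rule for the Hermitian matrix.\<close>

lemma dual_explicit:
  "dual y (1, 0) = (1 / hdet y) *\<^sub>R (g y (0, 1) (0, 1) *\<^sub>R (1, 0)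
    + ((- g y (1, 0) (0, 1)) *\<^sub>R (0, 1) + (- g y (1, 0) (0, \<i>)) *\<^sub>R (0, \<i>)))"
  "dual y (0, 1) = (1 / hdet y) *\<^sub>R (g y (1, 0) (1, 0) *\<^sub>R (0, 1)
    + ((- g y (1, 0) (0, 1)) *\<^sub>R (1, 0) + g y (1, 0) (0, \<i>) *\<^sub>R (\<i>, 0)))"
  unfolding dual_def
  by (rule sharp_unique; subst complex2_linear_expand[OF linear_g(1)]; unfold g_linear;
    use hdet_pos[of y] in \<open>simp add: g_basis inner_prod_def inner_complex_def field_simps\<close>;
    simp add: hdet_def power2_eq_square algebra_simps)+

lemma dual_i:
  "dual y (\<i>, 0) = i_mult (dual y (1, 0))" "dual y (0, \<i>) = i_mult (dual y (0, 1))"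
  using dual_J[of y "(1, 0)"] dual_J[of y "(0, 1)"] by simp_all

text \<open>Jacobi's formula. The real determinant is the square of \<open>hdet\<close>, which
  matches the factor 1/2 in \<open>\<tau>_eq\<close>.\<close>

lemma has_derivative_hdet: "(hdet has_derivative (\<lambda>u. hdet y * \<tau> y u)) (at y)"
proof -
  have i: "dg y u (\<i>, 0) (i_mult v) = dg y u (1, 0) v" "dg y u (0, \<i>) (i_mult v) = dg y u (0, 1) v"
    "dg y u (0, 1) (\<i>, 0) = - dg y u (1, 0) (0, \<i>)" for u v
    using dg_J[of y u "(1, 0)" v] dg_J[of y u "(0, 1)" v] dg_J[of y u "(1, 0)" "(0, \<i>)"]
      linear_neg[OF dg_linear3, of y u "(\<i>, 0)" "(0, 1)"] dg_sym[of y u "(0, 1)" "(\<i>, 0)"]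
    by simp_all
  have "\<tau> y u = dg y u (1, 0) (dual y (1, 0)) + dg y u (0, 1) (dual y (0, 1))" for u
    by (simp add: \<tau>_eq sum_Basis_complex2 dual_i i)
  also have "\<dots> u = (g y (0, 1) (0, 1) * dg y u (1, 0) (1, 0) + g y (1, 0) (1, 0) * dg y u (0, 1) (0, 1)
      - 2 * g y (1, 0) (0, 1) * dg y u (1, 0) (0, 1) - 2 * g y (1, 0) (0, \<i>) * dg y u (1, 0) (0, \<i>)) / hdet y" for u
    unfolding dual_explicit dg_simps
    by (simp add: i dg_sym[of y u "(0, 1)" "(1, 0)"] add_divide_distrib diff_divide_distrib)
  finally have "hdet y * \<tau> y u = g y (0, 1) (0, 1) * dg y u (1, 0) (1, 0) + g y (1, 0) (1, 0) * dg y u (0, 1) (0, 1)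
      - 2 * g y (1, 0) (0, 1) * dg y u (1, 0) (0, 1) - 2 * g y (1, 0) (0, \<i>) * dg y u (1, 0) (0, \<i>)" for u
    using hdet_pos[of y] by simp
  then show ?thesis
    unfolding hdet_def[abs_def]
    by (auto intro!: derivative_eq_intros has_derivative_g simp: algebra_simps)
qed

end

section \<open>Admissible metrics in a chart\<close>

text \<open>
  \<open>\<sigma>\<close> is the sign of the weight of the real flow of \<open>grad z\<close> on the fibre coordinate: \<open>-1\<close> in the charts
  around the zero section, where \<open>z\<close> is maximal, and \<open>1\<close> in the charts around the infinity section.
\<close>

locale admissible_chart = kaehler_surface_chart g + base: conformal_chart gB
  for g :: "(complex \<times> complex) metric_field" and gB :: "complex metric_field" +
  fixes x \<sigma> :: real and z :: "complex \<times> complex \<Rightarrow> real" and F F' F'' :: "real \<Rightarrow> real"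
  assumes x: "0 < x" "x < 1" and \<sigma>: "\<sigma> * \<sigma> = 1"
    and scal_base: "scal gB w = 4"
    and z_C2: "Ck_on 2 UNIV z"
    and grad_z: "g y (0, \<sigma> *\<^sub>R snd y) u = dir_deriv z y u"
    and z_regular: "snd y \<noteq> 0 \<Longrightarrow> -1 < z y \<and> z y < 1"
    and F: "\<And>t. -1 < t \<Longrightarrow> t < 1 \<Longrightarrow> F t > 0"
      "\<And>t. -1 < t \<Longrightarrow> t < 1 \<Longrightarrow> (F has_real_derivative F' t) (at t)"
      "\<And>t. -1 < t \<Longrightarrow> t < 1 \<Longrightarrow> (F' has_real_derivative F'' t) (at t)"
    and metric: "snd y \<noteq> 0 \<Longrightarrow> g y u v = (1 + x * z y) / x * gB (fst y) (fst u) (fst v)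
      + (dir_deriv z y u * dir_deriv z y v + dir_deriv z y (i_mult u) * dir_deriv z y (i_mult v))
        / (F (z y) / (1 + x * z y))"
begin

abbreviation dz :: "complex \<times> complex \<Rightarrow> complex \<times> complex \<Rightarrow> real"
  where "dz \<equiv> dir_deriv z"

text \<open>The gradient of \<open>z\<close>: \<open>J\<close> times it generates the circle action,
  so it is linear in the fibre coordinate and its derivative is constant.\<close>

definition X :: "complex \<times> complex \<Rightarrow> complex \<times> complex"
  where "X y = (0, \<sigma> *\<^sub>R snd y)"

definition \<Theta> :: "complex \<times> complex \<Rightarrow> real"
  where "\<Theta> y = F (z y) / (1 + x * z y)"

definition h :: "complex \<Rightarrow> real"
  where "h w = gB w 1 1"

lemma h_pos: "h w > 0"
  unfolding h_def by (rule base.pos) simp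

lemma momentum_pos: "-1 < z y \<Longrightarrow> 1 + x * z y > 0"
  using x mult_strict_left_mono[of "-1" "z y" x] by simp

lemma z_differentiable: "z differentiable (at y)"
  using Ck_on_SucD(1)[of 1 z] z_C2 by (simp add: numeral_2_eq_2)

lemma linear_dz: "linear (dz y)"
  by (rule dir_deriv_linear[OF z_differentiable])

lemma has_derivative_z: "(z has_derivative dz y) (at y)"
  by (rule has_dir_deriv[OF z_differentiable])

lemma dz_differentiable: "(\<lambda>y. dz y u) differentiable (at y0)"
proof -
  have "Ck_on 1 UNIV (\<lambda>y. dz y u)"
    using Ck_on_SucD(2) z_C2 unfolding numeral_2_eq_2 One_nat_def by blast
  then show ?thesis unfolding One_nat_def by (rule Ck_on_SucD(1))
qed

lemma g_X: "g y (X y) u = dz y u"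
  unfolding X_def by (rule grad_z)

lemma has_derivative_X: "(X has_derivative (\<lambda>u. (0, \<sigma> *\<^sub>R snd u))) (at y)"
  unfolding X_def[abs_def]
  by (intro has_derivative_Pair has_derivative_const has_derivative_scaleR_right has_derivative_snd
      has_derivative_ident)

lemma dir_deriv_X: "dir_deriv X y u = (0, \<sigma> *\<^sub>R snd u)"
  by (rule dir_deriv_eqI[OF has_derivative_X])

lemma \<Theta>_pos: "snd y \<noteq> 0 \<Longrightarrow> \<Theta> y > 0"
  using z_regular[of y] F(1) momentum_pos[of y] by (simp add: \<Theta>_def)

text \<open>\<open>X\<close> is vertical and \<open>dz\<close> vanishes on \<open>J X\<close>, so
  the metric formula at \<open>(X, X)\<close> reads \<open>N = N * N / \<Theta>\<close> with
  \<open>N = dz y (X y)\<close>, and \<open>N\<close> is positive.\<close>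

lemma dz_X:
  assumes "snd y \<noteq> 0"
  shows "dz y (X y) = \<Theta> y" "dz y (i_mult (X y)) = 0"
proof -
  have "g y (X y) (i_mult (X y)) = 0"
    using g_J_left[of y "X y" "X y"] sym[of y "X y" "i_mult (X y)"] by simp
  then show 0: "dz y (i_mult (X y)) = 0" by (simp add: g_X)
  have "X y \<noteq> 0" using assms \<sigma> by (auto simp: X_def zero_prod_def)
  then have p: "dz y (X y) > 0" using pos[of "X y" y] by (simp add: g_X)
  have "dz y (X y) = dz y (X y) * dz y (X y) / \<Theta> y"
    using metric[OF assms, of "X y" "X y"] 0 base.linear_g
    by (simp add: g_X[symmetric] \<Theta>_def[symmetric] X_def linear_0)
  then show "dz y (X y) = \<Theta> y" using p \<Theta>_pos[OF assms] by (simp add: field_simps)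
qed

text \<open>The values of \<open>dz\<close> on \<open>X\<close> and \<open>J X\<close> arise from
  its two fibre components by complex multiplication with the fibre coordinate up to conjugation and
  sign; the identity is multiplicativity of the norm.\<close>

lemma dz_fibre:
  assumes "snd y \<noteq> 0"
  shows "((dz y (0, 1))\<^sup>2 + (dz y (0, \<i>))\<^sup>2) * (snd y \<bullet> snd y) = (\<Theta> y)\<^sup>2"
proof -
  define a b where "a = dz y (0, 1)" and "b = dz y (0, \<i>)"
  define p q where "p = Re (snd y)" and "q = Im (snd y)"
  have eqs: "dz y (X y) = \<sigma> * (p * a + q * b)" "dz y (i_mult (X y)) = \<sigma> * (p * b - q * a)"
    by (subst complex2_linear_expand[OF linear_dz]; simp add: X_def a_def b_def p_def q_def algebra_simps)+
  have "(\<Theta> y)\<^sup>2 = (\<sigma> * (p * a + q * b))\<^sup>2 + (\<sigma> * (p * b - q * a))\<^sup>2"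
    unfolding eqs[symmetric] dz_X[OF assms] by simp
  also have "\<dots> = (\<sigma> * \<sigma>) * ((p * a + q * b)\<^sup>2 + (p * b - q * a)\<^sup>2)" by algebra
  also have "\<dots> = (a\<^sup>2 + b\<^sup>2) * (p * p + q * q)" unfolding \<sigma> by algebra
  finally show ?thesis by (simp add: a_def b_def p_def q_def inner_complex_def)
qed

lemma g_fibre:
  assumes "snd y \<noteq> 0"
  shows "g y (0, 1) (0, 1) = \<Theta> y / (snd y \<bullet> snd y)"
proof -
  have "g y (0, 1) (0, 1) = ((dz y (0, 1))\<^sup>2 + (dz y (0, \<i>))\<^sup>2) / \<Theta> y"
    unfolding metric[OF assms] \<Theta>_def[symmetric]
    using base.linear_g(1)[THEN linear_0] by (simp add: power2_eq_square)
  moreover have "(dz y (0, 1))\<^sup>2 + (dz y (0, \<i>))\<^sup>2 = (\<Theta> y)\<^sup>2 / (snd y \<bullet> snd y)"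
    using dz_fibre[OF assms] assms by (simp add: eq_divide_eq)
  ultimately show ?thesis
    using \<Theta>_pos[OF assms] by (simp add: power2_eq_square)
qed

text \<open>The part of the metric made of \<open>dz\<close> is a Hermitian form of rank one, so the
  determinant reduces to the base entry times the fibre entry; the cancellation is Lagrange's
  identity for two squares.\<close>

lemma hdet_regular:
  assumes "snd y \<noteq> 0"
  shows "hdet y = (1 + x * z y) / x * h (fst y) * g y (0, 1) (0, 1)"
    "hdet y = h (fst y) * F (z y) / (x * (snd y \<bullet> snd y))"
proof -
  define a b c d where "a = dz y (1, 0)" and "b = dz y (\<i>, 0)" and "c = dz y (0, 1)" and "d = dz y (0, \<i>)"
  define P where "P = (1 + x * z y) / x"
  have P: "P > 0" using x momentum_pos[of y] z_regular[OF assms] by (simp add: P_def)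
  have neg: "dz y (0, -1) = - c" "dz y (-1, 0) = - a"
    using linear_neg[OF linear_dz, of y "(0, 1)"] linear_neg[OF linear_dz, of y "(1, 0)"]
    by (simp_all add: a_def c_def)
  have g_eqs: "g y (1, 0) (1, 0) = P * h (fst y) + (a\<^sup>2 + b\<^sup>2) / \<Theta> y" "g y (0, 1) (0, 1) = (c\<^sup>2 + d\<^sup>2) / \<Theta> y"
    "g y (1, 0) (0, 1) = (a * c + b * d) / \<Theta> y" "g y (1, 0) (0, \<i>) = (a * d - b * c) / \<Theta> y"
    unfolding metric[OF assms] \<Theta>_def[symmetric] P_def[symmetric]
    using base.linear_g(1)[THEN linear_0] neg
    by (simp_all add: power2_eq_square h_def a_def b_def c_def d_def)
  show 1: "hdet y = (1 + x * z y) / x * h (fst y) * g y (0, 1) (0, 1)"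
    using \<Theta>_pos[OF assms] unfolding P_def[symmetric] hdet_def g_eqs
    by (simp add: field_simps power2_eq_square)
  show "hdet y = h (fst y) * F (z y) / (x * (snd y \<bullet> snd y))"
    using momentum_pos[of y] z_regular[OF assms]
    unfolding 1 g_fibre[OF assms] \<Theta>_def by simp
qed

lemma open_regular: "open {y :: complex \<times> complex. snd y \<noteq> 0}"
  by (intro open_Collect_neq continuous_intros)

text \<open>Logarithmic differentiation of the closed form of \<open>hdet\<close>, compared with
  \<open>has_derivative_hdet\<close>.\<close>

lemma \<tau>_regular:
  assumes y: "snd y \<noteq> 0"
  shows "\<tau> y u = base.\<tau> (fst y) (fst u) + F' (z y) / F (z y) * dz y u
    - 2 * (snd y \<bullet> snd u) / (snd y \<bullet> snd y)"
proof -
  have zr: "-1 < z y" "z y < 1" using z_regular[OF y] by auto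
  have v: "snd y \<bullet> snd y > 0" using y by simp
  have snd: "(snd has_derivative snd) (at y)" by (rule has_derivative_snd[OF has_derivative_ident])
  have F1: "((\<lambda>y. F (z y)) has_derivative (\<lambda>u. F' (z y) * dz y u)) (at y)"
    using has_derivative_compose[OF has_derivative_z, of F "(*) (F' (z y))" y] F(2)[OF zr]
    by (simp add: has_field_derivative_def)
  have H: "((\<lambda>y. h (fst y)) has_derivative (\<lambda>u. base.dg (fst y) (fst u) 1 1)) (at y)"
    unfolding h_def
    by (rule has_derivative_compose[OF _ base.has_derivative_g]) (auto intro!: derivative_eq_intros)
  have "((\<lambda>y. h (fst y) * F (z y) / (x * (snd y \<bullet> snd y))) has_derivative
      (\<lambda>u. hdet y * (base.dg (fst y) (fst u) 1 1 / h (fst y) + F' (z y) / F (z y) * dz y u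
        - 2 * (snd y \<bullet> snd u) / (snd y \<bullet> snd y)))) (at y)"
  proof (rule has_derivative_eq_rhs[OF has_derivative_divide[OF has_derivative_mult[OF H F1]
        has_derivative_mult_right[OF has_derivative_inner[OF snd snd]]]], goal_cases)
    case 1
    then show ?case using v x by simp
  next
    case 2
    have alg: "- (k * f) * (inverse (x * s) * (x * (p + p)) * inverse (x * s)) + (k * (f' * dz) + dk * f) / (x * s)
      = k * f / (x * s) * (dk / k + f' / f * dz - 2 * p / s)"
      if "k > 0" "f > 0" "s > 0" for k f s p f' dz dk :: real
      using that x by (simp add: field_simps)
    show ?case
    proof
      fix u :: "complex \<times> complex"
      have c: "snd u \<bullet> snd y = snd y \<bullet> snd u" by (rule inner_commute)
      show "- (h (fst y) * F (z y)) * (inverse (x * (snd y \<bullet> snd y)) * (x * (snd y \<bullet> snd u + snd u \<bullet> snd y))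
          * inverse (x * (snd y \<bullet> snd y)))
        + (h (fst y) * (F' (z y) * dz y u) + base.dg (fst y) (fst u) 1 1 * F (z y)) / (x * (snd y \<bullet> snd y))
        = hdet y * (base.dg (fst y) (fst u) 1 1 / h (fst y) + F' (z y) / F (z y) * dz y u
          - 2 * (snd y \<bullet> snd u) / (snd y \<bullet> snd y))"
        unfolding hdet_regular(2)[OF y] c by (rule alg[OF h_pos F(1)[OF zr] v])
    qed
  qed
  moreover have "((\<lambda>y. h (fst y) * F (z y) / (x * (snd y \<bullet> snd y))) has_derivative
      (\<lambda>u. hdet y * \<tau> y u)) (at y)"
  proof (rule has_derivative_transform_within_open[OF has_derivative_hdet open_regular])
    show "hdet y = h (fst y) * F (z y) / (x * (snd y \<bullet> snd y))" if "y \<in> {y. snd y \<noteq> 0}" for y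
      using that by (intro hdet_regular(2)) simp
  qed (simp add: y)
  ultimately have "(\<lambda>u. hdet y * (base.dg (fst y) (fst u) 1 1 / h (fst y) + F' (z y) / F (z y) * dz y u
        - 2 * (snd y \<bullet> snd u) / (snd y \<bullet> snd y))) = (\<lambda>u. hdet y * \<tau> y u)"
    by (rule has_derivative_unique)
  from fun_cong[OF this, of u] show ?thesis
    using hdet_pos[of y] unfolding base.\<tau>_conformal h_def by simp
qed

text \<open>The trace \<open>2 * \<sigma>\<close> of the derivative of \<open>X\<close> cancels
  against the fibre-coordinate term of \<open>\<tau>\<close>.\<close>

lemma divergence_X_regular:
  assumes y: "snd y \<noteq> 0"
  shows "divergence g X y = F' (z y) / (1 + x * z y)"
proof -
  have "F (z y) > 0" using F(1) z_regular[OF y] by auto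
  moreover have "\<tau> y (X y) = F' (z y) / F (z y) * \<Theta> y - 2 * \<sigma>"
    unfolding \<tau>_regular[OF y] dz_X[OF y] using y
    by (simp add: X_def base.linear_\<tau>[THEN linear_0])
  ultimately show ?thesis
    by (simp add: divergence_eq dir_deriv_X sum_Basis_complex2 inner_prod_def inner_complex_def \<Theta>_def)
qed

text \<open>The metric formula is available only off the section, but \<open>X\<close> vanishes here
  and just the trace of its derivative remains.\<close>

lemma divergence_X_section:
  assumes y: "snd y = 0"
  shows "divergence g X y = 2 * \<sigma>"
proof -
  have "X y = 0" using y by (simp add: X_def zero_prod_def)
  then show ?thesis
    by (simp add: divergence_eq dir_deriv_X sum_Basis_complex2 inner_prod_def inner_complex_def
        linear_0[OF linear_\<tau>])
qed

definition ddz :: "complex \<times> complex \<Rightarrow> complex \<times> complex \<Rightarrow> complex \<times> complex \<Rightarrow> real"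
  where "ddz y e u = dir_deriv (\<lambda>y. dz y u) y e"

lemma d\<tau>_regular:
  assumes y: "snd y \<noteq> 0"
  shows "d\<tau> y e u = base.d\<tau> (fst y) (fst e) (fst u)
    + (F'' (z y) / F (z y) - (F' (z y) / F (z y))\<^sup>2) * (dz y e * dz y u) + F' (z y) / F (z y) * ddz y e u
    - 2 * ((snd e \<bullet> snd u) / (snd y \<bullet> snd y)
      - 2 * (snd y \<bullet> snd e) * (snd y \<bullet> snd u) / (snd y \<bullet> snd y)\<^sup>2)"
proof -
  have zr: "-1 < z y" "z y < 1" using z_regular[OF y] by auto
  have Fp: "F (z y) > 0" using F(1) zr by auto
  have v: "snd y \<bullet> snd y > 0" using y by simp
  have snd: "(snd has_derivative snd) (at y)" by (rule has_derivative_snd[OF has_derivative_ident])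
  have F1: "((\<lambda>y. F (z y)) has_derivative (\<lambda>u. F' (z y) * dz y u)) (at y)"
    using has_derivative_compose[OF has_derivative_z, of F "(*) (F' (z y))" y] F(2)[OF zr]
    by (simp add: has_field_derivative_def)
  have F2: "((\<lambda>y. F' (z y)) has_derivative (\<lambda>u. F'' (z y) * dz y u)) (at y)"
    using has_derivative_compose[OF has_derivative_z, of F' "(*) (F'' (z y))" y] F(3)[OF zr]
    by (simp add: has_field_derivative_def)
  have B: "((\<lambda>y. base.\<tau> (fst y) (fst u)) has_derivative (\<lambda>e. base.d\<tau> (fst y) (fst e) (fst u))) (at y)"
    unfolding base.d\<tau>_def
    by (rule has_derivative_compose[where g = "\<lambda>w. base.\<tau> w (fst u)", OF _ has_dir_deriv[OF base.\<tau>_differentiable]])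
      (auto intro!: derivative_eq_intros)
  have Z: "((\<lambda>y. dz y u) has_derivative (\<lambda>e. ddz y e u)) (at y)"
    unfolding ddz_def by (rule has_dir_deriv[OF dz_differentiable])
  have "((\<lambda>y. base.\<tau> (fst y) (fst u) + F' (z y) / F (z y) * dz y u
    - 2 * (snd y \<bullet> snd u) / (snd y \<bullet> snd y)) has_derivative (\<lambda>e. base.d\<tau> (fst y) (fst e) (fst u)
    + (F'' (z y) / F (z y) - (F' (z y) / F (z y))\<^sup>2) * (dz y e * dz y u) + F' (z y) / F (z y) * ddz y e u
    - 2 * ((snd e \<bullet> snd u) / (snd y \<bullet> snd y)
      - 2 * (snd y \<bullet> snd e) * (snd y \<bullet> snd u) / (snd y \<bullet> snd y)\<^sup>2))) (at y)"
  proof (rule has_derivative_eq_rhs[OF has_derivative_diff[OF has_derivative_add[OF B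
        has_derivative_mult[OF has_derivative_divide[OF F2 F1] Z]]
        has_derivative_divide[OF has_derivative_mult_right[OF has_derivative_inner_left[OF snd]]
          has_derivative_inner[OF snd snd]]]], goal_cases)
    case 1
    then show ?case using Fp by simp
  next
    case 2
    then show ?case using v by simp
  next
    case 3
    have alg: "b + (f1 / f * dd + (- f1 * (inverse f * (f1 * dz) * inverse f) + f2 * dz / f) * dzu)
      - (- (2 * vu) * (inverse s * (ve + ve) * inverse s) + 2 * eu / s)
      = b + (f2 / f - (f1 / f)\<^sup>2) * (dz * dzu) + f1 / f * dd - 2 * (eu / s - 2 * ve * vu / s\<^sup>2)"
      if "f > 0" "s > 0" for b f f1 f2 dz dzu dd vu ve eu s :: real
      using that by (simp add: field_simps power2_eq_square)
    show ?case
      by (intro ext, subst (3) inner_commute, rule alg[OF Fp v])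
  qed
  then have "((\<lambda>y. \<tau> y u) has_derivative (\<lambda>e. base.d\<tau> (fst y) (fst e) (fst u)
    + (F'' (z y) / F (z y) - (F' (z y) / F (z y))\<^sup>2) * (dz y e * dz y u) + F' (z y) / F (z y) * ddz y e u
    - 2 * ((snd e \<bullet> snd u) / (snd y \<bullet> snd y)
      - 2 * (snd y \<bullet> snd e) * (snd y \<bullet> snd u) / (snd y \<bullet> snd y)\<^sup>2))) (at y)"
    by (rule has_derivative_transform_within_open[OF _ open_regular]) (use y \<tau>_regular in auto)
  then show ?thesis unfolding d\<tau>_def by (rule dir_deriv_eqI)
qed

text \<open>Takes the \<open>g\<close>-trace of \<open>d\<tau>_regular\<close> term by term: T1 is
  the base curvature, T2 the squared norm of \<open>dz\<close>, T3 the divergence of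
  \<open>X\<close>, T4 the fibre coordinate. The contributions quadratic in \<open>F'\<close>
  cancel.\<close>

theorem scal_regular:
  assumes y: "snd y \<noteq> 0"
  shows "scal g y = (4 * x - F'' (z y)) / (1 + x * z y)"
proof -
  define d D where "d = g y (0, 1) (0, 1)" and "D = hdet y"
  have Fp: "F (z y) > 0" using F(1) z_regular[OF y] by auto
  have P: "1 + x * z y > 0" using momentum_pos z_regular[OF y] by auto
  have hp: "h (fst y) > 0" by (rule h_pos)
  have d: "d > 0" unfolding d_def by (rule pos) (simp add: zero_prod_def)
  have D: "D > 0" "D = (1 + x * z y) / x * h (fst y) * d"
    unfolding D_def d_def by (rule hdet_pos, rule hdet_regular(1)[OF y])
  have zero: "base.d\<tau> w 0 u = 0" for w u
    using base.bilinear_d\<tau>[of w] by (rule bilinear_lzero)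
  have scale: "base.d\<tau> w u (r *\<^sub>R v) = r * base.d\<tau> w u v" for w u v r
    using bilinear_rmul[OF base.bilinear_d\<tau>] by simp
  have fst_dual: "fst (dual y (1, 0)) = (d / D) *\<^sub>R 1" "fst (dual y (\<i>, 0)) = (d / D) *\<^sub>R \<i>"
    by (simp_all add: dual_i dual_explicit d_def D_def scaleR_conv_of_real)
  have "(\<Sum>e\<in>Basis. base.d\<tau> (fst y) (fst e) (fst (dual y e))) = d / D * (base.d\<tau> (fst y) 1 1 + base.d\<tau> (fst y) \<i> \<i>)"
    unfolding sum_Basis_complex2 fst_conv fst_dual scale zero by (simp add: algebra_simps)
  also have "\<dots> = - 4 * x / (1 + x * z y)"
    using x P hp d by (simp add: base.scal_conformal scal_base h_def[symmetric] D(2))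
  finally have T1: "(\<Sum>e\<in>Basis. base.d\<tau> (fst y) (fst e) (fst (dual y e))) = - 4 * x / (1 + x * z y)" .
  have "(\<Sum>e\<in>Basis. dz y e * dz y (dual y e)) = (\<Sum>e\<in>Basis. (X y \<bullet> e) * dz y e)"
    by (simp add: g_X[symmetric, of y "dual y _"] dual_inner mult.commute)
  also have "\<dots> = \<Theta> y" by (simp add: linear_expand[OF linear_dz, symmetric] dz_X[OF y])
  finally have T2: "(\<Sum>e\<in>Basis. dz y e * dz y (dual y e)) = \<Theta> y" .
  have "X differentiable (at y)" using has_derivative_X by (rule differentiableI)
  from divergence_eq_trace[OF this] have T3: "(\<Sum>e\<in>Basis. ddz y e (dual y e)) = F' (z y) / (1 + x * z y)"
    by (simp add: divergence_X_regular[OF y] g_X ddz_def)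
  define a where "a = g y (1, 0) (1, 0)"
  have snd_dual: "snd (dual y (0, 1)) = (a / D) *\<^sub>R 1" "snd (dual y (0, \<i>)) = (a / D) *\<^sub>R \<i>"
    by (simp_all add: dual_i dual_explicit a_def D_def scaleR_conv_of_real)
  have v: "snd y \<bullet> snd y > 0" using y by simp
  \<comment> \<open>The summand is the Hessian of log |v| for the fibre coordinate v. This function
    is harmonic, and on the fibre covectors the inverse metric is the multiple \<open>a / D\<close>
    of the Euclidean one.\<close>
  have "(\<Sum>e\<in>Basis. (snd e \<bullet> snd (dual y e)) / (snd y \<bullet> snd y)
      - 2 * (snd y \<bullet> snd e) * (snd y \<bullet> snd (dual y e)) / (snd y \<bullet> snd y)\<^sup>2)
    = a / D * (2 / (snd y \<bullet> snd y) - 2 * (Re (snd y) * Re (snd y) + Im (snd y) * Im (snd y)) / (snd y \<bullet> snd y)\<^sup>2)"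
    unfolding sum_Basis_complex2 snd_conv snd_dual
    by (simp add: inner_complex_def algebra_simps add_divide_distrib)
  also have "\<dots> = 0" unfolding inner_complex_def[symmetric] using v by (simp add: power2_eq_square)
  finally have T4: "(\<Sum>e\<in>Basis. (snd e \<bullet> snd (dual y e)) / (snd y \<bullet> snd y)
      - 2 * (snd y \<bullet> snd e) * (snd y \<bullet> snd (dual y e)) / (snd y \<bullet> snd y)\<^sup>2) = 0" .
  have scal_sum: "scal g y = - ((\<Sum>e\<in>Basis. base.d\<tau> (fst y) (fst e) (fst (dual y e)))
    + (F'' (z y) / F (z y) - (F' (z y) / F (z y))\<^sup>2) * (\<Sum>e\<in>Basis. dz y e * dz y (dual y e))
    + F' (z y) / F (z y) * (\<Sum>e\<in>Basis. ddz y e (dual y e))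
    - 2 * (\<Sum>e\<in>Basis. (snd e \<bullet> snd (dual y e)) / (snd y \<bullet> snd y)
      - 2 * (snd y \<bullet> snd e) * (snd y \<bullet> snd (dual y e)) / (snd y \<bullet> snd y)\<^sup>2))"
    unfolding scal_eq d\<tau>_regular[OF y] by (simp only: sum.distrib sum_subtractf sum_distrib_left[symmetric])
  have alg: "- (- 4 * x / p + (f2 / f - (f1 / f)\<^sup>2) * (f / p) + f1 / f * (f1 / p) - 2 * 0) = (4 * x - f2) / p"
    if "f > 0" "p > 0" for f f1 f2 p :: real
    using that by (simp add: field_simps power2_eq_square)
  show ?thesis
    unfolding scal_sum T1 T2 T3 T4 \<Theta>_def by (rule alg[OF Fp P])
qed

end

section \<open>Smoothness of affine combinations and of functions of one variable\<close>

lemma Ck_on_affine: "Ck_on k UNIV f \<Longrightarrow> Ck_on k UNIV (\<lambda>y. b * f y + c :: real)"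
proof (induction k arbitrary: f c)
  case 0
  then show ?case by (auto intro!: continuous_intros)
next
  case (Suc k)
  have f: "f differentiable (at y)" "Ck_on k UNIV (\<lambda>y. dir_deriv f y v)" for y v
    using Ck_on_SucD[OF Suc.prems] by auto
  \<comment> \<open>The summand 0 keeps the derivative in the affine shape that the induction
    hypothesis expects.\<close>
  have D: "((\<lambda>y. b * f y + c) has_derivative (\<lambda>v. b * dir_deriv f y v + 0)) (at y)" for y
    using has_dir_deriv[OF f(1)] by (auto intro!: derivative_eq_intros)
  then have "(\<lambda>y. b * f y + c) differentiable_on UNIV"
    by (auto simp: differentiable_on_def intro: differentiableI)
  moreover have "Ck_on k UNIV (\<lambda>y. dir_deriv (\<lambda>y. b * f y + c) y v)" for v
    unfolding dir_deriv_eqI[OF D] by (rule Suc.IH[OF f(2)])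
  ultimately show ?case by (simp only: Ck_on.simps) blast
qed

lemma smooth_fun_affine:
  assumes "\<And>i. Img M i = UNIV" "smooth_fun M f"
  shows "smooth_fun M (\<lambda>q. b * f q + c)"
  using assms Ck_on_affine[of _ "loc M _ f" b c]
  by (simp add: smooth_fun_def smooth_on_def loc_def[abs_def])

lemma smooth_on_real_derivative:
  fixes f :: "real \<Rightarrow> real"
  assumes "open T" "smooth_on T f"
  shows "\<And>t. t \<in> T \<Longrightarrow> (f has_real_derivative dir_deriv f t 1) (at t)"
    and "smooth_on T (\<lambda>t. dir_deriv f t 1)"
proof -
  have S: "Ck_on (Suc k) T f" for k using assms(2) unfolding smooth_on_def by blast
  show "(f has_real_derivative dir_deriv f t 1) (at t)" if "t \<in> T" for t
  proof -
    have "f differentiable_on T" using S[of 0] unfolding Ck_on.simps by blast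
    then have f: "f differentiable (at t)"
      using that assms(1) unfolding differentiable_on_def by (metis at_within_open)
    have "dir_deriv f t v = dir_deriv f t 1 * v" for v
      using linear_cmul[OF dir_deriv_linear[OF f], of v 1] by (simp add: mult.commute)
    then have "dir_deriv f t = (*) (dir_deriv f t 1)" by (rule ext)
    with has_dir_deriv[OF f] show ?thesis unfolding has_field_derivative_def by metis
  qed
  show "smooth_on T (\<lambda>t. dir_deriv f t 1)"
    using S unfolding smooth_on_def Ck_on.simps by blast
qed

section \<open>Killing potentials and weighted curvature of functions of the moment map\<close>

context admissible_chart
begin

lemma grad_affine: "grad g (\<lambda>y. c * z y + d) y = c *\<^sub>R X y"
proof -
  have "((\<lambda>y. c * z y + d) has_derivative (\<lambda>v. c * dz y v + 0)) (at y)"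
    by (auto intro!: derivative_eq_intros has_derivative_z)
  from dir_deriv_eqI[OF this] show ?thesis
    unfolding grad_def by (intro sharp_unique) (simp add: g_X)
qed

text \<open>The gradient is a real multiple of \<open>X\<close>, which is complex linear in the
  coordinates and hence holomorphic.\<close>

lemma lie_endo_grad_affine: "lie_endo (grad g (\<lambda>y. c * z y + d)) (\<lambda>_. i_mult) y v = 0"
proof -
  have "grad g (\<lambda>y. c * z y + d) = (\<lambda>y. c *\<^sub>R X y)" by (rule ext) (rule grad_affine)
  moreover have "((\<lambda>y. c *\<^sub>R X y) has_derivative (\<lambda>v. c *\<^sub>R (0, \<sigma> *\<^sub>R snd v))) (at y)"
    by (intro has_derivative_scaleR_right has_derivative_X)
  ultimately show ?thesis
    by (simp add: lie_endo_def dir_deriv_eqI prod_eq_iff)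
qed

lemma laplacian_affine: "laplacian g (\<lambda>y. c * z y + d) y = - c * divergence g X y"
proof -
  have "grad g (\<lambda>y. c * z y + d) = (\<lambda>y. c *\<^sub>R X y)" by (rule ext) (rule grad_affine)
  moreover have "dir_deriv (\<lambda>y. c *\<^sub>R X y) y e = c *\<^sub>R dir_deriv X y e" for e
    unfolding dir_deriv_X by (intro dir_deriv_eqI has_derivative_scaleR_right has_derivative_X)
  ultimately show ?thesis
    by (simp add: laplacian_def divergence_eq linear_cmul[OF linear_\<tau>] sum_distrib_left sum_negf algebra_simps)
qed

lemma g_X_X:
  assumes "snd y \<noteq> 0 \<or> F (z y) = 0"
  shows "g y (X y) (X y) = F (z y) / (1 + x * z y)"
proof (cases "snd y = 0")
  case True
  then have "X y = 0" by (simp add: X_def zero_prod_def)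
  with True assms show ?thesis by simp
next
  case False
  then show ?thesis by (simp add: g_X dz_X \<Theta>_def)
qed

text \<open>\<open>F0\<close> and \<open>F1\<close> carry the formulas across the sections, where
  the norm and divergence of \<open>X\<close> are computed from \<open>X = 0\<close> instead of from
  the metric formula.\<close>

lemma weighted_scal_affine:
  assumes F0: "snd y = 0 \<Longrightarrow> F (z y) = 0" and F1: "snd y = 0 \<Longrightarrow> F' (z y) / (1 + x * z y) = 2 * \<sigma>"
  shows "weighted_scal g (\<lambda>y. b * z y + 1) p y = (b * z y + 1)\<^sup>2 * scal g y
    + 2 * (p - 1) * b * (b * z y + 1) * F' (z y) / (1 + x * z y)
    - p * (p - 1) * b\<^sup>2 * F (z y) / (1 + x * z y)"
proof -
  have "divergence g X y = F' (z y) / (1 + x * z y)"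
    using F1 divergence_X_section divergence_X_regular by metis
  moreover have "g y (X y) (X y) = F (z y) / (1 + x * z y)" using F0 by (intro g_X_X) blast
  ultimately show ?thesis
    by (simp add: weighted_scal_def grad_affine laplacian_affine power2_eq_square mult_ac)
qed

text \<open>The gradient of \<open>s (z y)\<close> is \<open>s' (z y)\<close> times the holomorphic
  field \<open>X\<close>. Evaluating the Lie derivative of \<open>J\<close> on \<open>X\<close>
  leaves only \<open>s'' * \<Theta>\<close> times \<open>J X\<close>, and neither \<Theta> nor
  \<open>J X\<close> vanishes.\<close>

lemma killing_profile:
  assumes y: "snd y \<noteq> 0"
    and s: "\<And>t. -1 < t \<Longrightarrow> t < 1 \<Longrightarrow> (s has_real_derivative s' t) (at t)"
      "\<And>t. -1 < t \<Longrightarrow> t < 1 \<Longrightarrow> (s' has_real_derivative s'' t) (at t)"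
    and S: "\<And>y. snd y \<noteq> 0 \<Longrightarrow> S y = s (z y)"
    and killing: "\<And>v. lie_endo (grad g S) (\<lambda>_. i_mult) y v = 0"
  shows "s'' (z y) = 0"
proof -
  have grad_S: "grad g S y = s' (z y) *\<^sub>R X y" if y: "snd y \<noteq> 0" for y
  proof -
    have zr: "-1 < z y" "z y < 1" using z_regular[OF y] by auto
    have "((\<lambda>y. s (z y)) has_derivative (\<lambda>u. s' (z y) * dz y u)) (at y)"
      using has_derivative_compose[OF has_derivative_z, of s "(*) (s' (z y))" y] s(1)[OF zr]
      by (simp add: has_field_derivative_def)
    then have "(S has_derivative (\<lambda>u. s' (z y) * dz y u)) (at y)"
      by (rule has_derivative_transform_within_open[OF _ open_regular]) (use y S in auto)
    from dir_deriv_eqI[OF this] show ?thesis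
      unfolding grad_def by (intro sharp_unique) (simp add: g_X)
  qed
  have zr: "-1 < z y" "z y < 1" using z_regular[OF y] by auto
  have "((\<lambda>y. s' (z y)) has_derivative (\<lambda>u. s'' (z y) * dz y u)) (at y)"
    using has_derivative_compose[OF has_derivative_z, of s' "(*) (s'' (z y))" y] s(2)[OF zr]
    by (simp add: has_field_derivative_def)
  from has_derivative_scaleR[OF this has_derivative_X]
  have "(grad g S has_derivative
      (\<lambda>u. s' (z y) *\<^sub>R (0, \<sigma> *\<^sub>R snd u) + (s'' (z y) * dz y u) *\<^sub>R X y)) (at y)"
    by (rule has_derivative_transform_within_open[OF _ open_regular]) (use y grad_S in auto)
  note D = dir_deriv_eqI[OF this]
  have "lie_endo (grad g S) (\<lambda>_. i_mult) y (X y) = (s'' (z y) * \<Theta> y) *\<^sub>R i_mult (X y)"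
    by (simp add: lie_endo_def D dz_X[OF y] linear_add[OF linear_i_mult] linear_cmul[OF linear_i_mult]
        prod_eq_iff)
  moreover have "i_mult (X y) \<noteq> 0" using y \<sigma> by (auto simp: X_def zero_prod_def)
  ultimately show ?thesis using killing \<Theta>_pos[OF y] by simp
qed

end

text \<open>Extends an identity known off a section across it, by a limit along the fibre.\<close>

lemma continuous_zero_on_line:
  fixes f :: "complex \<times> complex \<Rightarrow> real"
  assumes "continuous_on UNIV f" "\<And>y. snd y \<noteq> 0 \<Longrightarrow> f y = 0"
  shows "f y = 0"
proof (cases "snd y = 0")
  case True
  have "continuous_on UNIV (\<lambda>r. f (fst y, r))"
    by (intro continuous_on_compose2[OF assms(1)] continuous_intros) auto
  then have "((\<lambda>r. f (fst y, r)) \<longlongrightarrow> f (fst y, 0)) (at 0)" by (simp add: continuous_on_def)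
  moreover have "((\<lambda>r. f (fst y, r)) \<longlongrightarrow> 0) (at 0)"
    by (rule tendsto_eventually) (simp add: eventually_at_filter assms(2))
  ultimately have "f (fst y, 0) = 0" by (intro tendsto_unique[OF trivial_limit_at])
  with True show ?thesis by (metis prod.collapse)
qed (rule assms(2))

section \<open>The extremal profile and the twin parameter\<close>

text \<open>Two integrations bring in two constants besides \<open>A\<close> and \<open>B\<close>;
  the four boundary conditions leave the relation for \<open>k\<close>. The formula for
  \<open>F''\<close> is given only inside the interval, and continuity carries the integrated
  identities to the endpoints.\<close>

lemma calabi_profile:
  fixes x A B :: real and F F' F'' :: "real \<Rightarrow> real"
  assumes x: "0 < x" "x < 1"
    and F: "\<And>t. -1 \<le> t \<Longrightarrow> t \<le> 1 \<Longrightarrow> (F has_real_derivative F' t) (at t)"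
      "\<And>t. -1 \<le> t \<Longrightarrow> t \<le> 1 \<Longrightarrow> (F' has_real_derivative F'' t) (at t)"
    and F'': "\<And>t. -1 < t \<Longrightarrow> t < 1 \<Longrightarrow> F'' t = 4 * x - (1 + x * t) * (A * t + B)"
    and bd: "F (-1) = 0" "F 1 = 0" "F' (-1) = 2 * (1 - x)" "F' 1 = - 2 * (1 + x)"
  shows "\<exists>k. k * (3 - x\<^sup>2) = (1 - x) * x\<^sup>2 \<and> x * A = 12 * k \<and> B = 4 * x + 2 - 4 * k
    \<and> (\<forall>t\<in>{-1..1}. F t = (1 - t\<^sup>2) * (1 + x * t) - k * (1 - t\<^sup>2)\<^sup>2
      \<and> F' t = x + 2 * (2 * k - 1) * t - 3 * x * t\<^sup>2 - 4 * k * t ^ 3)"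
proof -
  \<comment> \<open>First and second primitives of the prescribed \<open>F''\<close>, both vanishing
    at 0.\<close>
  define Q' where "Q' t = 4 * x * t - (B * t + (A + x * B) * t\<^sup>2 / 2 + x * A * t ^ 3 / 3)" for t
  define Q where "Q t = 2 * x * t\<^sup>2 - (B * t\<^sup>2 / 2 + (A + x * B) * t ^ 3 / 6 + x * A * t ^ 4 / 12)" for t
  have Q': "(Q' has_real_derivative 4 * x - (1 + x * t) * (A * t + B)) (at t)" for t
    unfolding Q'_def by (auto intro!: derivative_eq_intros simp: field_simps power2_eq_square)
  have Q: "(Q has_real_derivative Q' t) (at t)" for t
    unfolding Q_def Q'_def by (auto intro!: derivative_eq_intros simp: field_simps power2_eq_square power3_eq_cube)
  define c1 where "c1 = F' (-1) - Q' (-1)"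
  have const: "G t = G (-1)"
    if "\<And>t. -1 \<le> t \<Longrightarrow> t \<le> 1 \<Longrightarrow> (G has_real_derivative G' t) (at t)"
      "\<And>t. -1 < t \<Longrightarrow> t < 1 \<Longrightarrow> G' t = 0" "-1 \<le> t" "t \<le> 1" for G G' :: "real \<Rightarrow> real" and t
  proof (rule DERIV_isconst2[of "-1" 1])
    show "continuous_on {-1..1} G"
      by (rule DERIV_continuous_on, rule has_field_derivative_at_within, rule that(1)) simp_all
    show "(G has_real_derivative 0) (at t)" if "-1 < t" "t < 1" for t
      using \<open>\<And>t. -1 \<le> t \<Longrightarrow> t \<le> 1 \<Longrightarrow> (G has_real_derivative G' t) (at t)\<close>[of t]
        \<open>\<And>t. -1 < t \<Longrightarrow> t < 1 \<Longrightarrow> G' t = 0\<close>[OF that] that by simp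
  qed (use that(3,4) in simp_all)
  have F'_eq: "F' t = Q' t + c1" if "-1 \<le> t" "t \<le> 1" for t
    using const[OF DERIV_diff[OF F(2) Q'] _ that] F'' by (simp add: c1_def)
  define c0 where "c0 = F (-1) - Q (-1) + c1"
  have "((\<lambda>t. c1 * t) has_real_derivative c1) (at t)" for t
    by (auto intro!: derivative_eq_intros)
  note D = DERIV_diff[OF F(1) DERIV_add[OF Q this]]
  have F_eq: "F t = Q t + c1 * t + c0" if "-1 \<le> t" "t \<le> 1" for t
    using const[OF D _ that] F'_eq by (simp add: c0_def)
  have e: "Q (-1) - c1 + c0 = 0" "Q 1 + c1 + c0 = 0" "Q' (-1) + c1 = 2 * (1 - x)" "Q' 1 + c1 = - 2 * (1 + x)"
    using F_eq[of "-1"] F_eq[of 1] F'_eq[of "-1"] F'_eq[of 1] bd by (simp_all only: order.refl) simp_all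
  \<comment> \<open>Minus the leading coefficient of the quartic.\<close>
  define k where "k = x * A / 12"
  have c1: "c1 = (A + x * B) / 6" using e(1,2) by (simp add: Q_def field_simps)
  have AB: "A + x * B = 6 * x" using e(3,4) unfolding c1 by (simp add: Q'_def field_simps)
  have B: "B = 4 * x + 2 - 4 * k" using e(3,4) by (simp add: Q'_def k_def field_simps)
  have c0: "c0 = 1 - k" using e(1,2) B by (simp add: Q_def k_def field_simps)
  have A: "x * A = 12 * k" by (simp add: k_def)
  have "A + x * (4 * x + 2 - 4 * k) = 6 * x" using AB B by simp
  then have "x * A + x\<^sup>2 * (4 * x + 2 - 4 * k) = 6 * x\<^sup>2" by algebra
  then have k: "k * (3 - x\<^sup>2) = (1 - x) * x\<^sup>2" unfolding A by algebra
  have c1': "c1 = x" using c1 AB by simp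
  show ?thesis
  proof (intro exI[of _ k] conjI ballI k A B)
    fix t :: real assume "t \<in> {-1..1}"
    then have t: "-1 \<le> t" "t \<le> 1" by simp_all
    have "Q t = 2 * x * t\<^sup>2 - (B * t\<^sup>2 / 2 + 6 * x * t ^ 3 / 6 + 12 * k * t ^ 4 / 12)"
      by (simp add: Q_def AB A)
    also have "\<dots> = (2 * k - 1) * t\<^sup>2 - x * t ^ 3 - k * t ^ 4"
      unfolding B by (simp add: field_simps)
    finally show "F t = (1 - t\<^sup>2) * (1 + x * t) - k * (1 - t\<^sup>2)\<^sup>2"
      unfolding F_eq[OF t] c1' c0 by (simp add: field_simps power2_eq_square power3_eq_cube power4_eq_xxxx)
    have "Q' t = 4 * x * t - (B * t + 6 * x * t\<^sup>2 / 2 + 12 * k * t ^ 3 / 3)"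
      by (simp add: Q'_def AB A)
    then show "F' t = x + 2 * (2 * k - 1) * t - 3 * x * t\<^sup>2 - 4 * k * t ^ 3"
      unfolding F'_eq[OF t] c1' B by (simp add: field_simps)
  qed
qed

text \<open>
  The left-hand side is \<open>Scal\<^sub>f\<^sub>,\<^sub>4\<close> at \<open>z = t\<close> times \<open>1 + x t\<close>. It is a quadratic polynomial in \<open>t\<close> for
  every \<open>b\<close>, and the choice of \<open>b\<close> makes it divisible by \<open>1 + x t\<close>.
\<close>

lemma twin_identity:
  fixes x b k :: real
  assumes x: "0 < x" "x < 1"
    and k: "k * (3 - x\<^sup>2) = (1 - x) * x\<^sup>2"
    and b: "b * (1 + 2 * x - 3 * x\<^sup>2 + 2 * x ^ 3) = - (x * (1 - 4 * x + x\<^sup>2))"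
  obtains c d where "\<And>t. (b * t + 1)\<^sup>2 * (12 * k * t\<^sup>2 + 6 * x * t + (4 * x + 2 - 4 * k))
    + 6 * b * (b * t + 1) * (x + 2 * (2 * k - 1) * t - 3 * x * t\<^sup>2 - 4 * k * t ^ 3)
    - 12 * b\<^sup>2 * ((1 - t\<^sup>2) * (1 + x * t) - k * (1 - t\<^sup>2)\<^sup>2) = (1 + x * t) * (c * t + d)"
proof -
  \<comment> \<open>The coefficients of the left-hand polynomial; its terms of degree three and four
    cancel.\<close>
  define n0 n1 n2 where "n0 = 4 * x + 2 - 4 * k + 6 * b * x - 12 * b\<^sup>2 * (1 - k)"
    and "n1 = 6 * x + 8 * b * x - 8 * b + 16 * b * k - 6 * b\<^sup>2 * x"
    and "n2 = 12 * k - 6 * b * x + b\<^sup>2 * (4 * x + 2 - 4 * k)"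
  have "x\<^sup>2 < 1" using x by (simp add: power_less_one_iff)
  then have x3: "3 - x\<^sup>2 \<noteq> 0" by simp
  \<comment> \<open>\<open>n2 + x\<^sup>2 * n0 - x * n1\<close> is \<open>x\<^sup>2\<close> times
    the value at the root -1/x of 1 + x t. Multiplied by \<open>3 - x\<^sup>2\<close> and with
    \<open>k\<close> eliminated, it becomes \<open>6 * (1 - x\<^sup>2) * b * (b * E + x * (1 - 4 * x
    + x\<^sup>2))\<close>, where \<open>E\<close> is the denominator of \<open>b\<close>. Its roots
    in \<open>b\<close> are thus 0, the ordinary extremal case, and the given value.\<close>
  have "(n2 + x\<^sup>2 * n0 - x * n1) * (3 - x\<^sup>2) = 0"
    unfolding n0_def n1_def n2_def using k b by algebra
  then have n12: "n2 + x\<^sup>2 * n0 = x * n1" using x3 by simp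
  define c where "c = n2 / x"
  have n2: "n2 = c * x" using x by (simp add: c_def)
  have "x * n1 = x * (c + x * n0)" using n12 n2 by algebra
  then have n: "n2 = c * x" "n1 = c + x * n0" using x n2 by simp_all
  have "n0 + n1 * t + n2 * t\<^sup>2 = (1 + x * t) * (c * t + n0)" for t
    unfolding n by algebra
  moreover have "(b * t + 1)\<^sup>2 * (12 * k * t\<^sup>2 + 6 * x * t + (4 * x + 2 - 4 * k))
    + 6 * b * (b * t + 1) * (x + 2 * (2 * k - 1) * t - 3 * x * t\<^sup>2 - 4 * k * t ^ 3)
    - 12 * b\<^sup>2 * ((1 - t\<^sup>2) * (1 + x * t) - k * (1 - t\<^sup>2)\<^sup>2) = n0 + n1 * t + n2 * t\<^sup>2" for t
    unfolding n0_def n1_def n2_def by algebra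
  ultimately show thesis using that by metis
qed

text \<open>The denominator \<open>E\<close> is positive, and so are \<open>(1 - b) * E\<close> and
  \<open>(1 + b) * E\<close> by explicit factorisation or expansion. The numerator vanishes in the
  unit interval only at 2 - sqrt 3.\<close>

lemma twin_parameter:
  fixes x b :: real
  assumes x: "0 < x" "x < 1" "x \<noteq> 2 - sqrt 3"
    and b: "b = - (x * (1 - 4 * x + x\<^sup>2)) / (1 + 2 * x - 3 * x\<^sup>2 + 2 * x ^ 3)"
  shows "-1 < b" "b < 1" "b \<noteq> 0"
    "b * (1 + 2 * x - 3 * x\<^sup>2 + 2 * x ^ 3) = - (x * (1 - 4 * x + x\<^sup>2))"
proof -
  define E where "E = 1 + 2 * x - 3 * x\<^sup>2 + 2 * x ^ 3"
  have "E = (1 - x) * (1 + 3 * x) + 2 * x ^ 3" unfolding E_def by algebra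
  then have E: "E > 0" using x by (simp add: add_pos_pos)
  show bE: "b * (1 + 2 * x - 3 * x\<^sup>2 + 2 * x ^ 3) = - (x * (1 - 4 * x + x\<^sup>2))"
    using E unfolding b E_def[symmetric] by simp
  have "(1 - b) * E = (1 - x) * (1 + x + 3 * x * (1 - x))"
    using bE unfolding E_def by algebra
  moreover have "(1 - x) * (1 + x + 3 * x * (1 - x)) > 0" using x by (simp add: add_pos_pos)
  ultimately have "1 - b > 0" using E by (metis zero_less_mult_pos2)
  then show "b < 1" by simp
  have "(1 + b) * E = 1 + x + x\<^sup>2 + x ^ 3"
    using bE unfolding E_def by algebra
  moreover have "1 + x + x\<^sup>2 + x ^ 3 > 0" using x by (simp add: add_pos_pos)
  ultimately have "1 + b > 0" using E by (metis zero_less_mult_pos2)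
  then show "-1 < b" by simp
  show "b \<noteq> 0"
  proof
    assume "b = 0"
    then have "x * (1 - 4 * x + x\<^sup>2) = 0" using bE by simp
    then have "1 - 4 * x + x\<^sup>2 = 0" using x(1) by (metis mult_eq_0_iff less_irrefl)
    then have "(2 - x)\<^sup>2 = 3" by algebra
    then have "sqrt 3 = 2 - x" using x by (intro real_sqrt_unique) auto
    with x show False by simp
  qed
qed

section \<open>Calabi's metric\<close>

lemma f1_pt_sections:
  "f1_pt (i, j) y \<in> zero_section \<longleftrightarrow> j = OffInf \<and> snd y = 0"
  "f1_pt (i, j) y \<in> infinity_section \<longleftrightarrow> j = OffZero \<and> snd y = 0"
  unfolding zero_section_def infinity_section_def mem_Collect_eq
  by (transfer, auto split: base_chart.splits fibre_chart.splits)+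

lemma regular_imgI:
  assumes "snd y \<noteq> 0"
  shows "y \<in> regular_img i"
proof -
  have "f1_pt i y \<in> Dom F1 i \<inter> F1_regular"
    using assms by (cases i) (simp add: F1_def F1_regular_def f1_pt_sections)
  moreover have "y = Crd F1 i (f1_pt i y)" by (simp add: F1_def)
  ultimately show ?thesis unfolding regular_img_def by blast
qed

text \<open>The value of \<sigma> in each chart: scaling the summand \<O> rotates
  \<open>a / s\<close> backwards and \<open>s / a\<close> forwards.\<close>

fun weight :: "fibre_chart \<Rightarrow> real"
  where "weight OffInf = -1" | "weight OffZero = 1"

lemma circle_gen_weight: "circle_gen i y = i_mult (0, weight (snd i) *\<^sub>R snd y)"
  by (cases i; cases y; cases "snd i") (auto simp: circle_gen_simps)

lemma smooth_funD:
  assumes "smooth_fun F1 f"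
  shows "Ck_on k UNIV (loc F1 i f)" "continuous_on UNIV (loc F1 i f)"
proof -
  show "Ck_on k UNIV (loc F1 i f)" for k
    using assms unfolding smooth_fun_def smooth_on_def Img_F1 by blast
  from this[of 0] show "continuous_on UNIV (loc F1 i f)" by simp
qed

lemma loc_section:
  assumes "{q. z q = 1} = zero_section" "{q. z q = -1} = infinity_section" "snd y = 0"
  shows "loc F1 i z y = - weight (snd i)"
  using assms f1_pt_sections[of "fst i" "snd i" y]
  by (cases i; cases "snd i") (auto simp: loc_def pt_F1)

text \<open>In the fibre over the base coordinate 0, the unit segments of the two fibre charts meet
  at coordinate 1 and join the zero section to the infinity section; the intermediate value theorem
  applies along this path.\<close>

lemma moment_map_surj:
  assumes "smooth_fun F1 z" and sections: "{q. z q = 1} = zero_section" "{q. z q = -1} = infinity_section"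
    and t: "-1 < t" "t < 1"
  obtains i y where "snd y \<noteq> 0" "loc F1 i z y = t"
proof -
  define p where "p j r = loc F1 (U0, j) z (0, complex_of_real r)" for j r
  have cont: "continuous_on {0..1} (p j)" for j
    unfolding p_def
    by (intro continuous_on_compose2[OF smooth_funD(2)[OF assms(1)]] continuous_intros) auto
  have "f1_pt (U0, OffInf) (0, 1) = f1_pt (U0, OffZero) (0, 1)"
    by transfer (auto simp: f1_rel_def zero_prod_def intro!: exI[of _ 1])
  then have mid: "p OffInf 1 = p OffZero 1" by (simp add: p_def loc_def pt_F1)
  have ends: "p OffInf 0 = 1" "p OffZero 0 = -1"
    using loc_section[OF sections] by (simp_all add: p_def)
  have "\<exists>j r. p j r = t"
  proof (cases "p OffInf 1 \<le> t")
    case True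
    then show ?thesis using IVT2'[of "p OffInf" 1 t 0] cont ends t by auto
  next
    case False
    then show ?thesis using IVT'[of "p OffZero" 0 t 1] cont ends mid t by auto
  qed
  then obtain j r where r: "p j r = t" by blast
  have "r \<noteq> 0"
  proof
    assume "r = 0"
    then show False using r ends t by (cases j) auto
  qed
  then show thesis using that[of "(0, complex_of_real r)" "(U0, j)"] r by (simp add: p_def)
qed

section \<open>From the admissible data to the extremal profile\<close>

text \<open>The relation between \<open>dz\<close>, \<open>J\<close> and \<theta> eliminates the
  connection form from the metric, and the moment map equation identifies the gradient with the
  scaled fibre coordinate field.\<close>

lemma admissible_chartI:
  assumes adm: "admissible_metric x gB z \<theta> F g" and x: "0 < x" "x < 1"
    and F: "\<And>t. -1 < t \<Longrightarrow> t < 1 \<Longrightarrow> (F has_real_derivative F' t) (at t)"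
      "\<And>t. -1 < t \<Longrightarrow> t < 1 \<Longrightarrow> (F' has_real_derivative F'' t) (at t)"
  shows "admissible_chart (g i) (gB (fst i)) x (weight (snd i)) (loc F1 i z) F F' F''"
proof -
  note adm' = adm[unfolded admissible_metric_def Let_def]
  have kB: "kaehler_metric CP1 gB" and sB: "is_scal CP1 gB (\<lambda>_. 4)" and kg: "kaehler_metric F1 g"
    and sz: "smooth_fun F1 z" and rz: "range z \<subseteq> {-1..1}"
    and sections: "{q. z q = 1} = zero_section" "{q. z q = -1} = infinity_section"
    and prof: "admissible_profile x F"
    using adm' by blast+
  have moment: "circle_gen i y = Imult F1 (grad (g i) (loc F1 i z) y)" for i y
    using adm' unfolding Img_F1 by blast
  have regular: "(\<forall>v. - dir_deriv (loc F1 i z) y (Imult F1 v) = F (loc F1 i z y) / (1 + x * loc F1 i z y) * \<theta> i y v) \<and>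
       (\<forall>u v. g i y u v = (1 + x * loc F1 i z y) / x * pullback_base gB i y u v
                + dir_deriv (loc F1 i z) y u * dir_deriv (loc F1 i z) y v / (F (loc F1 i z y) / (1 + x * loc F1 i z y))
                + F (loc F1 i z y) / (1 + x * loc F1 i z y) * \<theta> i y u * \<theta> i y v)"
    if "snd y \<noteq> 0" for y
    using adm' regular_imgI[OF that, of i] by blast
  interpret kaehler_chart "g i" i_mult by (rule kaehler_chart_F1[OF kg])
  interpret B: kaehler_chart "gB (fst i)" "(*) \<i>" by (rule kaehler_chart_CP1[OF kB])
  have z_diff: "loc F1 i z differentiable (at y)" for y
    using Ck_on_SucD(1)[OF smooth_funD(1)[OF sz]] .
  have z_range: "-1 \<le> loc F1 i z y" "loc F1 i z y \<le> 1" for y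
    using subsetD[OF rz rangeI, of "pt F1 i y"] by (simp_all add: loc_def)
  have z_regular: "-1 < loc F1 i z y" "loc F1 i z y < 1" if "snd y \<noteq> 0" for y
  proof -
    have "pt F1 i y \<notin> zero_section" "pt F1 i y \<notin> infinity_section"
      using that f1_pt_sections[of "fst i" "snd i" y] by (auto simp: pt_F1)
    then have "loc F1 i z y \<noteq> 1" "loc F1 i z y \<noteq> -1"
      unfolding sections[symmetric] loc_def by auto
    then show "-1 < loc F1 i z y" "loc F1 i z y < 1" using z_range[of y] by auto
  qed
  have F_pos: "F t > 0" if "-1 < t" "t < 1" for t
    using prof that unfolding admissible_profile_def by auto
  show ?thesis
  proof unfold_locales
    show "0 < x" "x < 1" by (rule x)+
    show "weight (snd i) * weight (snd i) = 1" by (cases "snd i") auto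
    show "scal (gB (fst i)) w = 4" for w
      using sB by (simp add: is_scal_def loc_def)
    show "Ck_on 2 UNIV (loc F1 i z)" by (rule smooth_funD(1)[OF sz])
    show "g i y (0, weight (snd i) *\<^sub>R snd y) u = dir_deriv (loc F1 i z) y u" for y u
    proof -
      have "i_mult (0, weight (snd i) *\<^sub>R snd y) = i_mult (grad (g i) (loc F1 i z) y)"
        using moment[of i y] by (simp only: Imult_F1 circle_gen_weight)
      from arg_cong[OF this, of i_mult]
      have "(0, weight (snd i) *\<^sub>R snd y) = grad (g i) (loc F1 i z) y"
        by (simp only: i_mult_simps(4) neg_equal_iff_equal)
      then show ?thesis
        unfolding grad_def using sharp_works[OF dir_deriv_linear[OF z_diff]] by simp
    qed
    show "-1 < loc F1 i z y \<and> loc F1 i z y < 1" if "snd y \<noteq> 0" for y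
      using z_regular[OF that] by blast
    show "F t > 0" if "-1 < t" "t < 1" for t by (rule F_pos[OF that])
    show "(F has_real_derivative F' t) (at t)" if "-1 < t" "t < 1" for t
      by (rule F(1)[OF that])
    show "(F' has_real_derivative F'' t) (at t)" if "-1 < t" "t < 1" for t
      by (rule F(2)[OF that])
    fix y u v :: "complex \<times> complex"
    assume y: "snd y \<noteq> 0"
    define P where "P = 1 + x * loc F1 i z y"
    define dz where "dz = dir_deriv (loc F1 i z) y"
    have "x * loc F1 i z y > x * (-1)" using z_regular(1)[OF y] x by (intro mult_strict_left_mono) auto
    then have P: "P > 0" using x by (simp add: P_def)
    have T: "F (loc F1 i z y) / P > 0" using F_pos z_regular[OF y] P by simp
    have \<theta>_eq: "dz (i_mult u) = - (F (loc F1 i z y) / P * \<theta> i y u)" for u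
    proof -
      have "- dz (i_mult u) = F (loc F1 i z y) / P * \<theta> i y u"
        using regular[OF y] unfolding dz_def P_def Imult_F1 by blast
      then show ?thesis by simp
    qed
    have "g i y u v = P / x * gB (fst i) (fst y) (fst u) (fst v) + dz u * dz v / (F (loc F1 i z y) / P)
      + F (loc F1 i z y) / P * \<theta> i y u * \<theta> i y v"
      using regular[OF y] unfolding dz_def P_def pullback_base_def by blast
    also have "\<dots> = P / x * gB (fst i) (fst y) (fst u) (fst v)
      + (dz u * dz v + dz (i_mult u) * dz (i_mult v)) / (F (loc F1 i z y) / P)"
    proof -
      have "r + a / T + T * p * q = r + (a + - (T * p) * - (T * q)) / T" if "T > 0" for r a p q T :: real
        using that by (simp add: field_simps)
      from this[OF T] show ?thesis unfolding \<theta>_eq .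
    qed
    finally show "g i y u v = (1 + x * loc F1 i z y) / x * gB (fst i) (fst y) (fst u) (fst v)
      + (dir_deriv (loc F1 i z) y u * dir_deriv (loc F1 i z) y v
        + dir_deriv (loc F1 i z) y (i_mult u) * dir_deriv (loc F1 i z) y (i_mult v))
        / (F (loc F1 i z y) / (1 + x * loc F1 i z y))"
      unfolding P_def dz_def .
  qed
qed

lemma affine_from_second_derivative:
  fixes s s' s'' :: "real \<Rightarrow> real"
  assumes "\<And>t. -1 < t \<Longrightarrow> t < 1 \<Longrightarrow> (s has_real_derivative s' t) (at t)"
    "\<And>t. -1 < t \<Longrightarrow> t < 1 \<Longrightarrow> (s' has_real_derivative 0) (at t)" "-1 < t" "t < 1"
  shows "s t = s' 0 * t + s 0"
proof -
  have s': "s' r = s' 0" if "-1 < r" "r < 1" for r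
  proof (rule DERIV_isconst3[of "-1" 1 r 0])
    show "(s' has_real_derivative 0) (at t)" if "t \<in> {-1<..<1}" for t
      using that by (intro assms(2)) simp_all
  qed (use that in simp_all)
  have "s t - s' 0 * t = s 0 - s' 0 * 0"
  proof (rule DERIV_isconst3[of "-1" 1 t 0])
    fix r :: real
    assume r: "r \<in> {-1<..<1}"
    then have 1: "(s has_real_derivative s' 0) (at r)" using assms(1)[of r] s'[of r] by simp
    have 2: "((\<lambda>t. s' 0 * t) has_real_derivative s' 0) (at r)"
      by (auto intro!: derivative_eq_intros)
    from DERIV_diff[OF 1 2] show "((\<lambda>t. s t - s' 0 * t) has_real_derivative 0) (at r)"
      by simp
  qed (use assms(3,4) in simp_all)
  then show ?thesis by simp
qed

lemma killing_potential_affine: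
  assumes z: "smooth_fun F1 z"
    and chart: "\<And>i. admissible_chart (g i) (gB i) x (\<sigma> i) (loc F1 i z) F F' F''"
  shows "killing_potential F1 g (\<lambda>q. c * z q + d)"
proof -
  have "lie_endo (grad (g i) (\<lambda>y. c * loc F1 i z y + d)) (\<lambda>_. i_mult) y v = 0" for i y v
    by (rule admissible_chart.lie_endo_grad_affine[OF chart])
  then show ?thesis
    using smooth_fun_affine[OF Img_F1 z] by (simp add: killing_potential_def loc_def[abs_def] Imult_F1)
qed

text \<open>
  By \<open>killing_profile\<close> the scalar curvature \<open>(4 x - F'') / (1 + x z)\<close> is affine in \<open>z\<close>, so \<open>F\<close> is a
  quartic, which the four boundary conditions determine.
\<close>

lemma calabi_structure:
  assumes calabi: "calabi_metric x z g" and x: "0 < x" "x < 1"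
  obtains gB F F' F'' k where
    "\<And>i. admissible_chart (g i) (gB (fst i)) x (weight (snd i)) (loc F1 i z) F F' F''"
    "k * (3 - x\<^sup>2) = (1 - x) * x\<^sup>2"
    "\<And>t. -1 \<le> t \<Longrightarrow> t \<le> 1 \<Longrightarrow> F t = (1 - t\<^sup>2) * (1 + x * t) - k * (1 - t\<^sup>2)\<^sup>2"
    "\<And>t. -1 \<le> t \<Longrightarrow> t \<le> 1 \<Longrightarrow> F' t = x + 2 * (2 * k - 1) * t - 3 * x * t\<^sup>2 - 4 * k * t ^ 3"
    "\<And>i y. scal (g i) y = 12 * k / x * loc F1 i z y + (4 * x + 2 - 4 * k)"
proof -
  obtain gB \<theta> F where adm: "admissible_metric x gB z \<theta> F g" and ext: "extremal F1 g"
    using calabi unfolding calabi_metric_def by blast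
  have sz: "smooth_fun F1 z" and sections: "{q. z q = 1} = zero_section" "{q. z q = -1} = infinity_section"
    and prof: "admissible_profile x F"
    using adm unfolding admissible_metric_def by blast+
  obtain T where T: "open T" "{-1..1} \<subseteq> T" "smooth_on T F"
    using prof unfolding admissible_profile_def by blast
  define d :: "(real \<Rightarrow> real) \<Rightarrow> real \<Rightarrow> real" where "d f t = dir_deriv f t 1" for f t
  have d: "smooth_on T (d f)" "t \<in> T \<Longrightarrow> (f has_real_derivative d f t) (at t)"
    if "smooth_on T f" for f t
    using smooth_on_real_derivative[OF T(1) that] unfolding d_def[abs_def] by blast+
  \<comment> \<open>Two derivatives of the scalar curvature involve four of \<open>F\<close>;
    smoothness on the open set \<open>T\<close> makes them two-sided even at -1 and 1.\<close>
  define F' F'' F3 F4 where "F' = d F" and "F'' = d F'" and "F3 = d F''" and "F4 = d F3"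
  have D: "(F has_real_derivative F' t) (at t)" "(F' has_real_derivative F'' t) (at t)"
    "(F'' has_real_derivative F3 t) (at t)" "(F3 has_real_derivative F4 t) (at t)"
    if "-1 \<le> t" "t \<le> 1" for t
  proof -
    have t: "t \<in> T" using that T(2) by auto
    show "(F has_real_derivative F' t) (at t)" "(F' has_real_derivative F'' t) (at t)"
      "(F'' has_real_derivative F3 t) (at t)" "(F3 has_real_derivative F4 t) (at t)"
      unfolding F'_def F''_def F3_def F4_def by (intro d t T(3))+
  qed
  have chart: "admissible_chart (g i) (gB (fst i)) x (weight (snd i)) (loc F1 i z) F F' F''" for i
    by (rule admissible_chartI[OF adm x D(1,2)]) simp_all
  obtain S where S: "is_scal F1 g S" "killing_potential F1 g S"
    using ext unfolding extremal_def by blast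
  have sS: "smooth_fun F1 S" using S(2) unfolding killing_potential_def by blast
  have S_scal: "loc F1 i S y = scal (g i) y" for i y
    using S(1) unfolding is_scal_def Img_F1 by blast
  have S_lie: "lie_endo (grad (g i) (loc F1 i S)) (\<lambda>_. i_mult) y v = 0" for i y v
    using S(2) unfolding killing_potential_def Imult_F1 Img_F1 by blast
  define P where "P t = 1 + x * t" for t
  define s s' s'' where "s t = (4 * x - F'' t) / P t"
    and "s' t = - F3 t / P t - x * (4 * x - F'' t) / (P t)\<^sup>2"
    and "s'' t = - F4 t / P t + 2 * x * F3 t / (P t)\<^sup>2 + 2 * x\<^sup>2 * (4 * x - F'' t) / (P t) ^ 3" for t
  have P: "P t > 0" if "-1 < t" for t
    using mult_strict_left_mono[OF that x(1)] x(2) by (simp add: P_def)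
  have dP: "(P has_real_derivative x) (at t)" for t
    unfolding P_def by (auto intro!: derivative_eq_intros)
  have ds: "(s has_real_derivative s' t) (at t)" if "-1 < t" "t < 1" for t
    unfolding s_def[abs_def] s'_def using that P[OF that(1)]
    by (auto intro!: derivative_eq_intros D(3) dP simp: field_simps power2_eq_square)
  have ds': "(s' has_real_derivative s'' t) (at t)" if "-1 < t" "t < 1" for t
    unfolding s'_def[abs_def] s''_def using that P[OF that(1)]
    by (auto intro!: derivative_eq_intros D(3,4) dP simp: field_simps power2_eq_square power3_eq_cube)
  have S_regular: "loc F1 i S y = s (loc F1 i z y)" if "snd y \<noteq> 0" for i y
    using admissible_chart.scal_regular[OF chart that] by (simp add: S_scal s_def P_def)
  \<comment> \<open>Each value in the open interval is attained by the moment map off the sections,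
    so the pointwise Killing condition becomes an equation in \<open>t\<close>.\<close>
  have "s'' t = 0" if t: "-1 < t" "t < 1" for t
  proof -
    obtain i y where y: "snd y \<noteq> 0" "loc F1 i z y = t"
      using moment_map_surj[OF sz sections t] .
    show ?thesis
      unfolding y(2)[symmetric]
      by (rule admissible_chart.killing_profile[OF chart y(1) ds ds' S_regular S_lie])
  qed
  then have s_affine: "s t = s' 0 * t + s 0" if "-1 < t" "t < 1" for t
    using affine_from_second_derivative[OF ds _ that] ds' by metis
  have F''_eq: "F'' t = 4 * x - (1 + x * t) * (s' 0 * t + s 0)" if "-1 < t" "t < 1" for t
    using s_affine[OF that] P[OF that(1)] by (simp add: s_def P_def field_simps)
  have bd: "F (-1) = 0" "F 1 = 0" "F' (-1) = 2 * (1 - x)" "F' 1 = - 2 * (1 + x)"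
    using prof DERIV_unique[OF D(1)[of "-1"]] DERIV_unique[OF D(1)[of 1]]
    unfolding admissible_profile_def by auto
  have "\<exists>k. k * (3 - x\<^sup>2) = (1 - x) * x\<^sup>2 \<and> x * s' 0 = 12 * k \<and> s 0 = 4 * x + 2 - 4 * k
    \<and> (\<forall>t\<in>{-1..1}. F t = (1 - t\<^sup>2) * (1 + x * t) - k * (1 - t\<^sup>2)\<^sup>2
      \<and> F' t = x + 2 * (2 * k - 1) * t - 3 * x * t\<^sup>2 - 4 * k * t ^ 3)"
    by (rule calabi_profile[OF x D(1,2) F''_eq bd])
  then obtain k where k: "k * (3 - x\<^sup>2) = (1 - x) * x\<^sup>2" "x * s' 0 = 12 * k" "s 0 = 4 * x + 2 - 4 * k"
    and F: "\<And>t. -1 \<le> t \<Longrightarrow> t \<le> 1 \<Longrightarrow> F t = (1 - t\<^sup>2) * (1 + x * t) - k * (1 - t\<^sup>2)\<^sup>2"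
      "\<And>t. -1 \<le> t \<Longrightarrow> t \<le> 1 \<Longrightarrow> F' t = x + 2 * (2 * k - 1) * t - 3 * x * t\<^sup>2 - 4 * k * t ^ 3"
    by auto
  have "s' 0 = 12 * k / x" using k(2) x(1) by (simp add: field_simps)
  \<comment> \<open>Both sides are continuous, so the affine formula passes from the regular set to
    the sections.\<close>
  moreover have "loc F1 i S y - (s' 0 * loc F1 i z y + s 0) = 0" for i y
  proof (rule continuous_zero_on_line)
    show "continuous_on UNIV (\<lambda>y. loc F1 i S y - (s' 0 * loc F1 i z y + s 0))"
      by (intro continuous_intros smooth_funD sS sz)
    fix y :: "complex \<times> complex"
    assume y: "snd y \<noteq> 0"
    show "loc F1 i S y - (s' 0 * loc F1 i z y + s 0) = 0"
      using S_regular[OF y] s_affine[of "loc F1 i z y"] admissible_chart.z_regular[OF chart y]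
      by simp
  qed
  ultimately have "scal (g i) y = 12 * k / x * loc F1 i z y + (4 * x + 2 - 4 * k)" for i y
    using k(3) by (simp add: S_scal)
  from that[OF chart k(1) F this] show thesis .
qed

section \<open>Weighted extremality and the twins\<close>

text \<open>The alternative \<open>b = 0\<close> is the constant weight 1, so both members of the
  twin pair are covered.\<close>

lemma calabi_weighted_extremal:
  assumes calabi: "calabi_metric x z g" and x: "0 < x" "x < 1" and b: "-1 < b" "b < 1"
    "b * (1 + 2 * x - 3 * x\<^sup>2 + 2 * x ^ 3) = - (x * (1 - 4 * x + x\<^sup>2)) \<or> b = 0"
  shows "weighted_extremal F1 g (\<lambda>q. b * z q + 1) 4"
proof -
  obtain gB F F' F'' k where
    chart: "\<And>i. admissible_chart (g i) (gB (fst i)) x (weight (snd i)) (loc F1 i z) F F' F''"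
    and k: "k * (3 - x\<^sup>2) = (1 - x) * x\<^sup>2"
    and profile: "\<And>t. -1 \<le> t \<Longrightarrow> t \<le> 1 \<Longrightarrow> F t = (1 - t\<^sup>2) * (1 + x * t) - k * (1 - t\<^sup>2)\<^sup>2"
      "\<And>t. -1 \<le> t \<Longrightarrow> t \<le> 1 \<Longrightarrow> F' t = x + 2 * (2 * k - 1) * t - 3 * x * t\<^sup>2 - 4 * k * t ^ 3"
    and scal: "\<And>i y. scal (g i) y = 12 * k / x * loc F1 i z y + (4 * x + 2 - 4 * k)"
    by (rule calabi_structure[OF calabi x]) blast
  have kg: "kaehler_metric F1 g" and sz: "smooth_fun F1 z" and rz: "range z \<subseteq> {-1..1}"
    and sections: "{q. z q = 1} = zero_section" "{q. z q = -1} = infinity_section"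
    using calabi unfolding calabi_metric_def admissible_metric_def by blast+
  have z: "-1 \<le> z q" "z q \<le> 1" for q using subsetD[OF rz rangeI, of q] by auto
  note killing = killing_potential_affine[OF sz chart]
  \<comment> \<open>The left side is \<open>4 * x - F''\<close> for the quartic profile; the
    relation for \<open>k\<close> supplies the coefficient \<open>6 * x\<close>.\<close>
  have k_scal: "12 * k * t\<^sup>2 + 6 * x * t + (4 * x + 2 - 4 * k)
      = (1 + x * t) * (12 * k / x * t + (4 * x + 2 - 4 * k))" for t
  proof -
    define a where "a = 12 * k / x"
    have a: "12 * k = a * x" using x by (simp add: a_def)
    have "x * (6 * x) = x * (a + x * (4 * x + 2 - 4 * k))" using a k by algebra
    then have a': "6 * x = a + x * (4 * x + 2 - 4 * k)" using x by simp
    have ax: "a * x / x = a" using x by simp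
    show ?thesis unfolding a a' ax by algebra
  qed
  obtain c d where cd: "\<And>t. (b * t + 1)\<^sup>2 * (12 * k * t\<^sup>2 + 6 * x * t + (4 * x + 2 - 4 * k))
    + 6 * b * (b * t + 1) * (x + 2 * (2 * k - 1) * t - 3 * x * t\<^sup>2 - 4 * k * t ^ 3)
    - 12 * b\<^sup>2 * ((1 - t\<^sup>2) * (1 + x * t) - k * (1 - t\<^sup>2)\<^sup>2) = (1 + x * t) * (c * t + d)"
    using b(3)
  proof
    assume "b = 0"
    with that[of "12 * k / x" "4 * x + 2 - 4 * k"] show thesis by (simp add: k_scal)
  qed (use that twin_identity[OF x k] in blast)
  have ws: "weighted_scal (g i) (\<lambda>y. b * loc F1 i z y + 1) 4 y = c * loc F1 i z y + d" for i y
  proof -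
    interpret admissible_chart "g i" "gB (fst i)" x "weight (snd i)" "loc F1 i z" F F' F''
      by (rule chart)
    define t where "t = loc F1 i z y"
    have t: "-1 \<le> t" "t \<le> 1" using z by (simp_all add: t_def loc_def)
    have P: "1 + x * t > 0" using x t(1) mult_left_mono[of "-1" t x] by simp
    have sec: "t = - weight (snd i)" if "snd y = 0"
      using loc_section[OF sections that] by (simp add: t_def)
    \<comment> \<open>On the sections \<open>t\<close> is 1 or -1, and the endpoint values of
      \<open>F\<close> and \<open>F'\<close> meet the hypotheses of
      \<open>weighted_scal_affine\<close>.\<close>
    have "F t = 0" if "snd y = 0"
      unfolding profile(1)[OF t] using sec[OF that] by (cases "snd i") auto
    moreover have "F' t / (1 + x * t) = 2 * weight (snd i)" if "snd y = 0"
      unfolding profile(2)[OF t] using sec[OF that] P by (cases "snd i") (auto simp: field_simps)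
    ultimately have "weighted_scal (g i) (\<lambda>y. b * loc F1 i z y + 1) 4 y = (b * t + 1)\<^sup>2 * scal (g i) y
      + 6 * b * (b * t + 1) * F' t / (1 + x * t) - 12 * b\<^sup>2 * F t / (1 + x * t)"
      using weighted_scal_affine[of y b 4] by (simp add: t_def)
    also have "scal (g i) y = (12 * k * t\<^sup>2 + 6 * x * t + (4 * x + 2 - 4 * k)) / (1 + x * t)"
      unfolding k_scal scal t_def[symmetric] using P by simp
    also have "(b * t + 1)\<^sup>2 * \<dots> + 6 * b * (b * t + 1) * F' t / (1 + x * t) - 12 * b\<^sup>2 * F t / (1 + x * t)
      = ((1 + x * t) * (c * t + d)) / (1 + x * t)"
    proof -
      have "u * (v / p) + q / p - r / p = (u * v + q - r) / p" for u v p q r :: real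
        by (simp add: add_divide_distrib diff_divide_distrib)
      then show ?thesis unfolding cd[symmetric] profile(1)[OF t] profile(2)[OF t] .
    qed
    finally show ?thesis using P by (simp add: t_def)
  qed
  have "is_weighted_scal F1 g (\<lambda>q. b * z q + 1) 4 (\<lambda>q. c * z q + d)"
    using ws by (simp add: is_weighted_scal_def loc_def[abs_def])
  moreover have "b * z q + 1 > 0" for q
  proof -
    have "\<bar>b * z q\<bar> \<le> \<bar>b\<bar> * 1" unfolding abs_mult using z[of q] by (intro mult_left_mono) auto
    then show ?thesis using b by auto
  qed
  ultimately show ?thesis
    unfolding weighted_extremal_def using kg killing by blast
qed

theorem proposition1:
  fixes x b :: real
  assumes "0 < x" and "x < 1" and "x \<noteq> 2 - sqrt 3"
    and "b = - (x * (1 - 4 * x + x\<^sup>2)) / (1 + 2 * x - 3 * x\<^sup>2 + 2 * x ^ 3)"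
  shows "b \<in> {-1<..<0} \<union> {0<..<1} \<and>
    (\<forall>z g. calabi_metric x z g \<longrightarrow>
       extremal F1 g \<and> weighted_extremal F1 g (\<lambda>q. b * z q + 1) 4 \<and>
       kaehler_twins F1 4 g (\<lambda>_. 1) (\<lambda>q. b * z q + 1))"
proof (intro conjI allI impI)
  note b = twin_parameter[OF assms]
  show "b \<in> {-1<..<0} \<union> {0<..<1}" using b(1-3) by auto
  fix z g
  assume calabi: "calabi_metric x z g"
  then show "extremal F1 g" by (simp add: calabi_metric_def)
  show f: "weighted_extremal F1 g (\<lambda>q. b * z q + 1) 4"
    using calabi_weighted_extremal[OF calabi assms(1,2) b(1,2)] b(4) by blast
  have "weighted_extremal F1 g (\<lambda>_. 1) 4"
    using calabi_weighted_extremal[OF calabi assms(1,2), of 0] by simp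
  moreover have "\<not> (\<exists>c. \<forall>q. b * z q + 1 = c * 1)"
  proof
    assume "\<exists>c. \<forall>q. b * z q + 1 = c * 1"
    then obtain c where c: "b * z q + 1 = c" for q by auto
    have "{q. z q = 1} = zero_section" "{q. z q = -1} = infinity_section"
      using calabi unfolding calabi_metric_def admissible_metric_def by blast+
    \<comment> \<open>At these points the second weight equals 1 + b and 1 - b, so a constant ratio
      to the weight 1 would force \<open>b = 0\<close>.\<close>
    then have "z (f1_pt (U0, OffInf) 0) = 1" "z (f1_pt (U0, OffZero) 0) = -1"
      using f1_pt_sections[of U0 _ 0] by auto
    then show False using c[of "f1_pt (U0, OffInf) 0"] c[of "f1_pt (U0, OffZero) 0"] b(3) by simp
  qed
  ultimately show "kaehler_twins F1 4 g (\<lambda>_. 1) (\<lambda>q. b * z q + 1)"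
    using f by (simp add: kaehler_twins_def)
qed

end
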